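(* Let $A$ be an expansive $d\times d$ integer matrix and $\mathcal D\subset\mathbb Z^d$ a complete set of representatives for $\mathbb Z^d/A^T\mathbb Z^d$ such that $(A,\mathcal D)$ satisfies the tiling condition. Let $C=\{\theta_0,\dots,\theta_{p-1}\}$ be a simple cycle. Identities involving $\mathfrak d^{-1}$ and $\rho^{-1}$ are understood up to sets of measure zero. (i) The map $$\mathfrak d:X(A^T,\mathcal D)\times\tilde\Omega_C\to\mathcal S_A(C),\quad \mathfrak d(x,\omega)=(e^{2\pi ix},e^{2\pi i\tau_{\omega_0}x},e^{2\pi i\tau_{\omega_1}\tau_{\omega_0}x},\dots)$$ is a bijection up to sets of measure zero, and the map $$\hat i_C:\mathbb R^d\times\mathbb Z_p\to\mathcal S_A(C),\quad \hat i_C(x,j)=(e^{2\pi i((A^T)^{-n}x+\theta_{n+j})})_{n\in\mathbb N}$$ is a bijection. (ii) $$\hat i_C^{-1}(\mathfrak d(x,\omega))=(x-\theta_{j(\omega)}+k(\omega),\,j(\omega))\qquad(x\in X(A^T,\mathcal D),\ \omega\in\tilde\Omega_C),$$ $$\mathfrak d^{-1}(\hat i_C(x,j))=(y,\omega(k,j))\qquad(x\in\mathbb R^d,\ j\in\mathbb Z_p),$$ where $y\in X(A^T,\mathcal D)$ and $k\in\mathbb Z^d$ are (for a.e. $x$) uniquely defined by $x+\theta_j=y+k$. (iii) The following relations hold (commutative diagram): $$\mathfrak d\circ\rho^{-1}=\sigma_A\circ\mathfrak d\ \text{ on } X(A^T,\mathcal D)\times\tilde\Omega_C,\qquad \hat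 i_C\circ\alpha_{A,p}=\sigma_A\circ\hat i_C\ \text{ on }\mathbb R^d\times\mathbb Z_p,$$ where $\rho^{-1}$ maps $X(A^T,\mathcal D)\times\tilde\Omega_C$ to itself, $\sigma_A$ maps $\mathcal S_A(C)$ to itself and $\alpha_{A,p}(x,j)=(A^Tx,j-1)$.
   Context: $\mathbb N=\{0,1,2,\dots\}$. An integer matrix $A$ is expansive if all its eigenvalues $\lambda$ satisfy $|\lambda|>1$; $A^T$ is the transpose. For $x\in\mathbb R^d$, $e^{2\pi i x}:=(e^{2\pi i x_1},\dots,e^{2\pi i x_d})\in\mathbb T^d$; for $z=e^{2\pi i x}\in\mathbb T^d$ put $z^A:=e^{2\pi i A^Tx}$. The solenoid is $\mathcal S_A=\{(z_n)_{n\in\mathbb N}: z_n\in\mathbb T^d,\ z_{n+1}^A=z_n \text{ for all } n\in\mathbb N\}$, a compact abelian group under coordinatewise multiplication, with automorphism $\sigma_A(z_0,z_1,\dots)=(z_0^A,z_0,z_1,\dots)$. For $d\in\mathcal D$, $\tau_d(x)=(A^T)^{-1}(x+d)$. $\Omega=\mathcal D^{\mathbb N}$. $X(A^T,\mathcal D)=\{\sum_{j\ge1}(A^T)^{-j}d_j: d_j\in\mathcal D\}$. The tiling condition for $(A,\mathcal D)$: $X(A^T,\mathcal D)$ tiles $\mathbb R^d$ by $\mathbb Z^d$ up to measure zero, i.e. $\bigcup_{k\in\mathbb Z^d}(X+k)=\mathbb R^d$ up to a Lebesgue null set and $(X+k)\cap(X+k')$ is Lebesgue null for $k\neq k'$ in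 $\mathbb Z^d$. A finite set $C=\{\theta_0,\dots,\theta_{p-1}\}\subset\mathbb R^d$ is a cycle (associated to $l_0\dots l_{p-1}$, $l_i\in\mathcal D$) if $\tau_{l_0}\theta_0=\theta_1,\dots,\tau_{l_{p-2}}\theta_{p-2}=\theta_{p-1}$, $\tau_{l_{p-1}}\theta_{p-1}=\theta_0$. It is simple if $\theta_j\not\equiv\theta_{j'}\bmod\mathbb Z^d$ for $j\ne j'$. Indices of $\theta$ are modulo $p$; $\mathbb Z_p$ is the cyclic group of order $p$. For a cycle $C'$ associated to $m_0\dots m_{q-1}$, $\Omega_{C'}\subset\Omega$ is the set of words ending in the infinite repetition $\underline{m_0\dots m_{q-1}}$, and $\tilde\Omega_C:=\bigcup\{\Omega_{C'}: C'\text{ cycle contained in }(C-\mathbb Z^d)\cap X(A^T,\mathcal D)\}$, where $C-\mathbb Z^d=\{\theta_j-k\}$. $\hat i(x)=(e^{2\pi i(A^T)^{-n}x})_{n\in\mathbb N}$, $\chi_C=(e^{2\pi i\theta_n})_{n\in\mathbb N}$, $\mathcal S_A(C)=\bigcup_{j=0}^{p-1}\sigma_A^{-j}(\chi_C)\hat i(\mathbb R^d)$. Measures: on $X(A^T,\mathcal D)\times\tilde\Omega_C$, Lebesgue times counting measure; on $\mathbb R^d\times\mathbb Z_p$, Lebesgue times counting measure; on $\mathcal S_A(C)$, $\tilde\mu$ given by $\int f\,d\tilde\mu=\int_{\mathbb T^d}\sum_{(z_n)_n\in\mathcal S_A(C),\,z_0=z}f((z_n)_n)\,d\mu(z)$ with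 $\mu$ Haar measure on $\mathbb T^d$. $\rho(x,\omega_0\omega_1\dots)=(\tau_{\omega_0}x,\omega_1\omega_2\dots)$, with a.e. inverse $\rho^{-1}(x,\omega_0\omega_1\dots)=(A^Tx-\omega_x,\omega_x\omega_0\omega_1\dots)$, where $\omega_x$ is, for a.e. $x\in X(A^T,\mathcal D)$, the unique element of $\mathcal D$ with $x\in\tau_{\omega_x}(X(A^T,\mathcal D))$. For $a\in\mathbb Z^d$ and $j\in\mathbb Z_p$ there are unique $b\in\mathbb Z^d$, $d_0\in\mathcal D$ with $a-\theta_j=A^T(b-\theta_{j+1})+d_0$; put $\mathcal R_C(a-\theta_j)=b-\theta_{j+1}$. For $(k,j)\in\mathbb Z^d\times\mathbb Z_p$, $\omega(k,j)=\omega_0\omega_1\dots\in\tilde\Omega_C$ is given by $\omega_n=\mathcal R_C^n(k-\theta_j)-A^T\mathcal R_C^{n+1}(k-\theta_j)$. For $\omega\in\tilde\Omega_C$ of the form $\omega_0\dots\omega_{np-1}\underline{m_0\dots m_{q-1}}$, let $\eta_0$ be the fixed point of $\tau_{m_{q-1}}\cdots\tau_{m_0}$; then $j(\omega)\in\mathbb Z_p$ is the unique element with $\eta_0\in\theta_{j(\omega)}-\mathbb Z^d$, and $k(\omega)=\omega_0+A^T\omega_1+\dots+(A^T)^{np-1}\omega_{np-1}+\theta_{j(\omega)}-(A^T)^{np}\eta_0\in\mathbb Z^d$. *)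

theory Defs
  imports "HOL-Analysis.Analysis"
begin

text \<open>
  Integer vectors and integer matrices are real vectors and matrices with integer entries.  A
  family indexed by residues modulo \<open>p\<close> is a function on \<open>nat\<close> of which only the
  values at \<open>0, \<dots>, p - 1\<close> are used, and the cyclic group of order \<open>p\<close> is the set
  \<open>{..<p}\<close>.  The product \<open>*\<close> on \<^typ>\<open>complex ^ 'n\<close> is componentwise.
\<close>

definition int_vecs :: "(real ^ 'n) set" where
  "int_vecs = {x. \<forall>i. x $ i \<in> \<int>}"

definition int_matrix :: "real ^ 'n ^ 'n \<Rightarrow> bool" where
  "int_matrix A \<longleftrightarrow> (\<forall>i j. A $ i $ j \<in> \<int>)"

definition expansive :: "real ^ 'n ^ 'n \<Rightarrow> bool" where
  "expansive A \<longleftrightarrow>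
     (\<forall>(l :: complex) v. v \<noteq> 0 \<and> (\<chi> i j. complex_of_real (A $ i $ j)) *v v = l *s v \<longrightarrow> cmod l > 1)"

definition torus :: "(complex ^ 'n) set" where
  "torus = {z. \<forall>i. cmod (z $ i) = 1}"

definition texp :: "real ^ 'n \<Rightarrow> complex ^ 'n" where
  "texp x = (\<chi> i. exp (2 * complex_of_real pi * \<i> * complex_of_real (x $ i)))"

text \<open>For \<open>z\<close> in the torus and an integer matrix \<open>A\<close>, the value does not depend on the chosen
  logarithm of \<open>z\<close>, see \<open>torus_pow_texp\<close> below.\<close>

definition torus_pow :: "real ^ 'n ^ 'n \<Rightarrow> complex ^ 'n \<Rightarrow> complex ^ 'n" where
  "torus_pow A z = (THE w. \<exists>x. z = texp x \<and> w = texp (transpose A *v x))"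

definition solenoid :: "real ^ 'n ^ 'n \<Rightarrow> (nat \<Rightarrow> complex ^ 'n) set" where
  "solenoid A = {z. (\<forall>n. z n \<in> torus) \<and> (\<forall>n. torus_pow A (z (Suc n)) = z n)}"

definition sigma_map :: "real ^ 'n ^ 'n \<Rightarrow> (nat \<Rightarrow> complex ^ 'n) \<Rightarrow> (nat \<Rightarrow> complex ^ 'n)" where
  "sigma_map A z = (\<lambda>n. case n of 0 \<Rightarrow> torus_pow A (z 0) | Suc m \<Rightarrow> z m)"

definition tau :: "real ^ 'n ^ 'n \<Rightarrow> real ^ 'n \<Rightarrow> real ^ 'n \<Rightarrow> real ^ 'n" where
  "tau A d x = matrix_inv (transpose A) *v (x + d)"

definition complete_residues :: "real ^ 'n ^ 'n \<Rightarrow> (real ^ 'n) set \<Rightarrow> bool" where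
  "complete_residues A D \<longleftrightarrow>
     D \<subseteq> int_vecs \<and> (\<forall>z \<in> int_vecs. \<exists>!d. d \<in> D \<and> z - d \<in> (*v) (transpose A) ` int_vecs)"

text \<open>The digit \<open>d j\<close> below is the coefficient of the power \<open>-(j + 1)\<close> of the transpose.\<close>

definition attractor :: "real ^ 'n ^ 'n \<Rightarrow> (real ^ 'n) set \<Rightarrow> (real ^ 'n) set" where
  "attractor A D =
     {x. \<exists>d. (\<forall>j. d j \<in> D) \<and> (\<lambda>j. (((*v) (matrix_inv (transpose A))) ^^ Suc j) (d j)) sums x}"

definition tiling :: "real ^ 'n ^ 'n \<Rightarrow> (real ^ 'n) set \<Rightarrow> bool" where
  "tiling A D \<longleftrightarrow>
     - (\<Union>k \<in> int_vecs. (+) k ` attractor A D) \<in> null_sets lebesgue \<and>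
     (\<forall>k \<in> int_vecs. \<forall>k' \<in> int_vecs. k \<noteq> k' \<longrightarrow>
        ((+) k ` attractor A D) \<inter> ((+) k' ` attractor A D) \<in> null_sets lebesgue)"

definition is_cycle ::
  "real ^ 'n ^ 'n \<Rightarrow> (real ^ 'n) set \<Rightarrow> nat \<Rightarrow> (nat \<Rightarrow> real ^ 'n) \<Rightarrow> (nat \<Rightarrow> real ^ 'n) \<Rightarrow> bool" where
  "is_cycle A D p l \<theta> \<longleftrightarrow>
     0 < p \<and> (\<forall>i<p. l i \<in> D \<and> tau A (l i) (\<theta> i) = \<theta> (Suc i mod p))"

definition simple_cycle ::
  "real ^ 'n ^ 'n \<Rightarrow> (real ^ 'n) set \<Rightarrow> nat \<Rightarrow> (nat \<Rightarrow> real ^ 'n) \<Rightarrow> (nat \<Rightarrow> real ^ 'n) \<Rightarrow> bool" where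
  "simple_cycle A D p l \<theta> \<longleftrightarrow>
     is_cycle A D p l \<theta> \<and> (\<forall>i<p. \<forall>j<p. i \<noteq> j \<longrightarrow> \<theta> i - \<theta> j \<notin> int_vecs)"

definition words :: "(real ^ 'n) set \<Rightarrow> (nat \<Rightarrow> real ^ 'n) set" where
  "words D = {\<omega>. \<forall>n. \<omega> n \<in> D}"

definition Omega_word :: "(real ^ 'n) set \<Rightarrow> nat \<Rightarrow> (nat \<Rightarrow> real ^ 'n) \<Rightarrow> (nat \<Rightarrow> real ^ 'n) set" where
  "Omega_word D q m = {\<omega> \<in> words D. \<exists>N. \<forall>n. \<omega> (N + n) = m (n mod q)}"

definition Omega_tilde ::
  "real ^ 'n ^ 'n \<Rightarrow> (real ^ 'n) set \<Rightarrow> nat \<Rightarrow> (nat \<Rightarrow> real ^ 'n) \<Rightarrow> (nat \<Rightarrow> real ^ 'n) set" where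
  "Omega_tilde A D p \<theta> =
     \<Union> {Omega_word D q m | q m \<eta>. is_cycle A D q m \<eta> \<and>
           \<eta> ` {..<q} \<subseteq> {\<theta> j - k | j k. j < p \<and> k \<in> int_vecs} \<inter> attractor A D}"

definition ihat :: "real ^ 'n ^ 'n \<Rightarrow> real ^ 'n \<Rightarrow> nat \<Rightarrow> complex ^ 'n" where
  "ihat A x = (\<lambda>n. texp ((((*v) (matrix_inv (transpose A))) ^^ n) x))"

definition chi :: "nat \<Rightarrow> (nat \<Rightarrow> real ^ 'n) \<Rightarrow> nat \<Rightarrow> complex ^ 'n" where
  "chi p \<theta> = (\<lambda>n. texp (\<theta> (n mod p)))"

definition cycle_solenoid ::
  "real ^ 'n ^ 'n \<Rightarrow> nat \<Rightarrow> (nat \<Rightarrow> real ^ 'n) \<Rightarrow> (nat \<Rightarrow> complex ^ 'n) set" where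
  "cycle_solenoid A p \<theta> =
     (\<Union>j<p. {\<lambda>n. ((inv_into (solenoid A) (sigma_map A)) ^^ j) (chi p \<theta>) n * ihat A x n | x. True})"

text \<open>Normalised Haar measure on the torus: the image of Lebesgue measure on the half-open unit
  cube.  See \<open>torus_haar_prob\<close> and \<open>torus_haar_invariant\<close> below.\<close>

definition torus_haar :: "(complex ^ 'n) measure" where
  "torus_haar =
     distr (restrict_space lborel {x :: real ^ 'n. \<forall>i. 0 \<le> x $ i \<and> x $ i < 1})
           (restrict_space borel torus) texp"

text \<open>The \<open>\<sigma>\<close>-algebra is the trace of the Borel sets of the product topology.  That the set
  function below is a measure, and the resulting integral formula, are \<open>nn_integral_mu_tilde\<close>.\<close>

definition mu_tilde ::
  "real ^ 'n ^ 'n \<Rightarrow> nat \<Rightarrow> (nat \<Rightarrow> real ^ 'n) \<Rightarrow> (nat \<Rightarrow> complex ^ 'n) measure" where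
  "mu_tilde A p \<theta> =
     measure_of (cycle_solenoid A p \<theta>) (sets (restrict_space borel (cycle_solenoid A p \<theta>)))
       (\<lambda>E. \<integral>\<^sup>+ z. (\<integral>\<^sup>+ s. indicator E s \<partial>count_space {s \<in> cycle_solenoid A p \<theta>. s 0 = z}) \<partial>torus_haar)"

definition attractor_words ::
  "real ^ 'n ^ 'n \<Rightarrow> (real ^ 'n) set \<Rightarrow> nat \<Rightarrow> (nat \<Rightarrow> real ^ 'n) \<Rightarrow> ((real ^ 'n) \<times> (nat \<Rightarrow> real ^ 'n)) measure" where
  "attractor_words A D p \<theta> = lebesgue_on (attractor A D) \<Otimes>\<^sub>M count_space (Omega_tilde A D p \<theta>)"

definition space_cyc :: "nat \<Rightarrow> ((real ^ 'n) \<times> nat) measure" where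
  "space_cyc p = lebesgue \<Otimes>\<^sub>M count_space {..<p}"

definition bij_betw_ae :: "('a \<Rightarrow> 'b) \<Rightarrow> 'a measure \<Rightarrow> 'b measure \<Rightarrow> bool" where
  "bij_betw_ae f M N \<longleftrightarrow>
     (\<exists>S \<in> null_sets M. \<exists>T \<in> null_sets N. bij_betw f (space M - S) (space N - T))"

fun tau_word :: "real ^ 'n ^ 'n \<Rightarrow> (nat \<Rightarrow> real ^ 'n) \<Rightarrow> nat \<Rightarrow> real ^ 'n \<Rightarrow> real ^ 'n" where
  "tau_word A \<omega> 0 x = x"
| "tau_word A \<omega> (Suc n) x = tau A (\<omega> n) (tau_word A \<omega> n x)"

definition encode ::
  "real ^ 'n ^ 'n \<Rightarrow> (real ^ 'n) \<times> (nat \<Rightarrow> real ^ 'n) \<Rightarrow> nat \<Rightarrow> complex ^ 'n" where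
  "encode A = (\<lambda>(x, \<omega>) n. texp (tau_word A \<omega> n x))"

definition ihat_cycle ::
  "real ^ 'n ^ 'n \<Rightarrow> nat \<Rightarrow> (nat \<Rightarrow> real ^ 'n) \<Rightarrow> (real ^ 'n) \<times> nat \<Rightarrow> nat \<Rightarrow> complex ^ 'n" where
  "ihat_cycle A p \<theta> =
     (\<lambda>(x, j) n. texp ((((*v) (matrix_inv (transpose A))) ^^ n) x + \<theta> ((n + j) mod p)))"

definition rho :: "real ^ 'n ^ 'n \<Rightarrow> (real ^ 'n) \<times> (nat \<Rightarrow> real ^ 'n) \<Rightarrow> (real ^ 'n) \<times> (nat \<Rightarrow> real ^ 'n)" where
  "rho A = (\<lambda>(x, \<omega>). (tau A (\<omega> 0) x, \<lambda>n. \<omega> (Suc n)))"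

definition digit :: "real ^ 'n ^ 'n \<Rightarrow> (real ^ 'n) set \<Rightarrow> real ^ 'n \<Rightarrow> real ^ 'n" where
  "digit A D x = (THE d. d \<in> D \<and> x \<in> tau A d ` attractor A D)"

definition rho_inv ::
  "real ^ 'n ^ 'n \<Rightarrow> (real ^ 'n) set \<Rightarrow> (real ^ 'n) \<times> (nat \<Rightarrow> real ^ 'n) \<Rightarrow> (real ^ 'n) \<times> (nat \<Rightarrow> real ^ 'n)" where
  "rho_inv A D = (\<lambda>(x, \<omega>). (transpose A *v x - digit A D x, case_nat (digit A D x) \<omega>))"

definition alpha :: "real ^ 'n ^ 'n \<Rightarrow> nat \<Rightarrow> (real ^ 'n) \<times> nat \<Rightarrow> (real ^ 'n) \<times> nat" where
  "alpha A p = (\<lambda>(x, j). (transpose A *v x, (j + p - 1) mod p))"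

text \<open>The point \<open>v\<close> stands for \<open>a - \<theta>\<^sub>j\<close>; for a simple cycle it determines \<open>j\<close>.\<close>

definition R_cycle ::
  "real ^ 'n ^ 'n \<Rightarrow> (real ^ 'n) set \<Rightarrow> nat \<Rightarrow> (nat \<Rightarrow> real ^ 'n) \<Rightarrow> real ^ 'n \<Rightarrow> real ^ 'n" where
  "R_cycle A D p \<theta> v =
     (THE w. \<exists>a \<in> int_vecs. \<exists>j<p. \<exists>b \<in> int_vecs. \<exists>d \<in> D.
        v = a - \<theta> j \<and> w = b - \<theta> (Suc j mod p) \<and> v = transpose A *v w + d)"

definition omega_of ::
  "real ^ 'n ^ 'n \<Rightarrow> (real ^ 'n) set \<Rightarrow> nat \<Rightarrow> (nat \<Rightarrow> real ^ 'n) \<Rightarrow> real ^ 'n \<Rightarrow> nat \<Rightarrow> nat \<Rightarrow> real ^ 'n" where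
  "omega_of A D p \<theta> k j = (\<lambda>n.
     (R_cycle A D p \<theta> ^^ n) (k - \<theta> j) - transpose A *v (R_cycle A D p \<theta> ^^ Suc n) (k - \<theta> j))"

text \<open>\<open>\<omega>\<close> is a prefix of length \<open>n * p\<close> followed by the infinite repetition of
  \<open>m 0, \<dots>, m (q - 1)\<close>, and \<open>\<eta>\<close> is the fixed point belonging to the repeated word.  The prefix
  and the repeated word are not determined by \<open>\<omega>\<close>, but \<open>j_of\<close> and \<open>k_of\<close> do not depend on
  their choice.\<close>

definition periodic_rep ::
  "real ^ 'n ^ 'n \<Rightarrow> nat \<Rightarrow> (nat \<Rightarrow> real ^ 'n) \<Rightarrow> nat \<Rightarrow> nat \<Rightarrow> (nat \<Rightarrow> real ^ 'n) \<Rightarrow> real ^ 'n \<Rightarrow> bool" where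
  "periodic_rep A p \<omega> n q m \<eta> \<longleftrightarrow>
     0 < q \<and> (\<forall>i. \<omega> (n * p + i) = m (i mod q)) \<and> tau_word A m q \<eta> = \<eta>"

definition j_of :: "real ^ 'n ^ 'n \<Rightarrow> nat \<Rightarrow> (nat \<Rightarrow> real ^ 'n) \<Rightarrow> (nat \<Rightarrow> real ^ 'n) \<Rightarrow> nat" where
  "j_of A p \<theta> \<omega> =
     (THE j. j < p \<and> (\<exists>n q m \<eta>. periodic_rep A p \<omega> n q m \<eta> \<and> \<eta> \<in> {\<theta> j - k | k. k \<in> int_vecs}))"

definition k_of :: "real ^ 'n ^ 'n \<Rightarrow> nat \<Rightarrow> (nat \<Rightarrow> real ^ 'n) \<Rightarrow> (nat \<Rightarrow> real ^ 'n) \<Rightarrow> real ^ 'n" where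
  "k_of A p \<theta> \<omega> =
     (THE k. k \<in> int_vecs \<and> (\<exists>n q m \<eta>. periodic_rep A p \<omega> n q m \<eta> \<and>
        k = (\<Sum>i<n * p. ((*v) (transpose A) ^^ i) (\<omega> i)) + \<theta> (j_of A p \<theta> \<omega>)
              - ((*v) (transpose A) ^^ (n * p)) \<eta>))"

lemma int_vecs_simps [simp]:
  "0 \<in> int_vecs" "x \<in> int_vecs \<Longrightarrow> - x \<in> int_vecs"
  "x \<in> int_vecs \<Longrightarrow> y \<in> int_vecs \<Longrightarrow> x + y \<in> int_vecs"
  "x \<in> int_vecs \<Longrightarrow> y \<in> int_vecs \<Longrightarrow> x - y \<in> int_vecs"
  by (auto simp: int_vecs_def)

lemma int_matrix_mult:
  assumes "int_matrix A" "x \<in> int_vecs"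
  shows "transpose A *v x \<in> int_vecs"
  using assms by (auto simp: int_matrix_def int_vecs_def matrix_vector_mult_def transpose_def intro!: Ints_sum)

lemma countable_int_vecs: "countable (int_vecs :: (real ^ 'n) set)"
proof -
  have "int_vecs \<subseteq> range (\<lambda>v :: int ^ 'n. \<chi> i. real_of_int (v $ i))"
  proof
    fix x :: "real ^ 'n" assume "x \<in> int_vecs"
    then have "x = (\<chi> i. real_of_int ((\<chi> i. \<lfloor>x $ i\<rfloor>) $ i))"
      by (auto simp: vec_eq_iff int_vecs_def)
    then show "x \<in> range (\<lambda>v :: int ^ 'n. \<chi> i. real_of_int (v $ i))" by blast
  qed
  then show ?thesis
    by (rule countable_subset) simp
qed

lemma expansive_invertible:
  assumes "expansive A"
  shows "invertible (transpose A)"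
proof -
  have "x = 0" if x: "A *v x = 0" for x
  proof (rule ccontr)
    assume "x \<noteq> 0"
    define v :: "complex ^ 'a" where "v = (\<chi> i. complex_of_real (x $ i))"
    have "v \<noteq> 0" using \<open>x \<noteq> 0\<close> by (auto simp: v_def vec_eq_iff)
    moreover have "(\<chi> i j. complex_of_real (A $ i $ j)) *v v = 0 *s v"
    proof -
      have "(\<Sum>j\<in>UNIV. complex_of_real (A $ i $ j) * complex_of_real (x $ j)) = 0" for i
      proof -
        have "(\<Sum>j\<in>UNIV. A $ i $ j * x $ j) = 0"
          using x by (simp add: vec_eq_iff matrix_vector_mult_def)
        then have "complex_of_real (\<Sum>j\<in>UNIV. A $ i $ j * x $ j) = 0" by simp
        then show ?thesis by simp
      qed
      then show ?thesis
        by (simp add: vec_eq_iff matrix_vector_mult_def v_def)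
    qed
    ultimately show False using assms unfolding expansive_def by fastforce
  qed
  then have "invertible A"
    by (meson invertible_left_inverse matrix_left_invertible_ker)
  then show ?thesis by (rule transpose_invertible)
qed

lemma matrix_inv_cancel:
  assumes "invertible B"
  shows "B *v (matrix_inv B *v x) = x" "matrix_inv B *v (B *v x) = x"
proof -
  have "B ** matrix_inv B = mat 1 \<and> matrix_inv B ** B = mat 1"
    using assms unfolding invertible_def matrix_inv_def by (rule someI_ex)
  then show "B *v (matrix_inv B *v x) = x" "matrix_inv B *v (B *v x) = x"
    by (simp_all add: matrix_vector_mul_assoc)
qed

lemma texp_add: "texp (x + y) = texp x * texp y"
  by (simp add: texp_def vec_eq_iff algebra_simps flip: exp_add)

lemma texp_in_torus [simp]: "texp x \<in> torus"
  by (simp add: texp_def torus_def)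

lemma texp_eq_iff: "texp x = texp y \<longleftrightarrow> x - y \<in> int_vecs"
proof -
  have "exp (2 * complex_of_real pi * \<i> * complex_of_real a) = exp (2 * complex_of_real pi * \<i> * complex_of_real b)
      \<longleftrightarrow> a - b \<in> \<int>" for a b
  proof -
    have "(2 * complex_of_real pi * \<i> * complex_of_real a =
            2 * complex_of_real pi * \<i> * complex_of_real b + of_int (2 * n) * complex_of_real pi * \<i>)
          \<longleftrightarrow> a - b = of_int n" for n
    proof -
      have "2 * complex_of_real pi * \<i> * complex_of_real b + of_int (2 * n) * complex_of_real pi * \<i>
            = 2 * complex_of_real pi * \<i> * complex_of_real (b + of_int n)"
        by (simp add: algebra_simps)
      then show ?thesis by (simp add: of_real_eq_iff del: of_real_add) (auto simp: algebra_simps)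
    qed
    then show ?thesis by (auto simp: exp_eq Ints_def)
  qed
  then show ?thesis by (simp add: texp_def vec_eq_iff int_vecs_def)
qed

lemma torus_pow_texp:
  assumes "int_matrix A"
  shows "torus_pow A (texp x) = texp (transpose A *v x)"
  unfolding torus_pow_def
proof (rule the_equality)
  fix w assume "\<exists>x'. texp x = texp x' \<and> w = texp (transpose A *v x')"
  then obtain x' where x': "x - x' \<in> int_vecs" "w = texp (transpose A *v x')"
    by (auto simp: texp_eq_iff)
  from int_matrix_mult[OF assms x'(1)]
  show "w = texp (transpose A *v x)"
    by (metis texp_eq_iff matrix_vector_mult_diff_distrib x'(2))
qed blast

lemma rho_rho_inv:
  assumes "expansive A"
  shows "rho A (rho_inv A D w) = w"
  using matrix_inv_cancel[OF expansive_invertible[OF assms]]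
  by (cases w) (simp add: rho_def rho_inv_def tau_def)

lemma rho_inv_rho:
  assumes "expansive A" "x \<in> attractor A D" "\<omega> 0 \<in> D"
    and "\<exists>!d. d \<in> D \<and> tau A (\<omega> 0) x \<in> tau A d ` attractor A D"
  shows "rho_inv A D (rho A (x, \<omega>)) = (x, \<omega>)"
proof -
  have "digit A D (tau A (\<omega> 0) x) = \<omega> 0"
    unfolding digit_def using assms by (intro the1_equality) auto
  moreover have "case_nat (\<omega> 0) (\<lambda>n. \<omega> (Suc n)) = \<omega>"
    by (auto simp: fun_eq_iff split: nat.splits)
  ultimately show ?thesis
    using matrix_inv_cancel[OF expansive_invertible[OF assms(1)]]
    by (simp add: rho_def rho_inv_def tau_def)
qed

text \<open>A Borel section of \<^const>\<open>texp\<close> over the torus, used only in proofs.\<close>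

definition tlog :: "complex ^ 'n \<Rightarrow> real ^ 'n" where
  "tlog z = (\<chi> i. (if 0 \<le> Im (z $ i) then 1 else - 1) * arccos (max (-1) (min 1 (Re (z $ i)))) / (2 * pi))"

lemma texp_tlog: "z \<in> torus \<Longrightarrow> texp (tlog z) = z"
proof -
  assume z: "z \<in> torus"
  have "exp (2 * complex_of_real pi * \<i> * complex_of_real (tlog z $ i)) = z $ i" for i
  proof -
    let ?w = "z $ i"
    have n: "cmod ?w = 1" using z by (simp add: torus_def)
    then have sq: "Re ?w ^ 2 + Im ?w ^ 2 = 1"
      using cmod_power2[of ?w] by simp
    have re: "\<bar>Re ?w\<bar> \<le> 1" using n abs_Re_le_cmod[of ?w] by simp
    then have mm: "max (-1) (min 1 (Re ?w)) = Re ?w" by auto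
    have s: "sin (arccos (Re ?w)) = \<bar>Im ?w\<bar>"
    proof -
      have "1 - Re ?w ^ 2 = Im ?w ^ 2" using sq by simp
      then show ?thesis using re by (simp add: sin_arccos_abs)
    qed
    have c: "cos (arccos (Re ?w)) = Re ?w" using re by (simp add: cos_arccos_abs)
    define t where "t = (if 0 \<le> Im ?w then 1 else - 1) * arccos (Re ?w)"
    have "2 * complex_of_real pi * \<i> * complex_of_real (tlog z $ i) = \<i> * complex_of_real t"
      by (simp add: tlog_def mm t_def)
    also have "exp (\<i> * complex_of_real t) = cis t" by (simp add: cis_conv_exp)
    also have "\<dots> = ?w" using s c by (auto simp: t_def complex_eq_iff)
    finally show ?thesis .
  qed
  then show ?thesis by (simp add: texp_def vec_eq_iff)
qed

lemma texp_measurable [measurable]: "(texp :: real ^ 'n \<Rightarrow> _) \<in> borel_measurable borel"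
  unfolding texp_def
  by (intro borel_measurable_continuous_onI continuous_intros)

lemma tlog_measurable [measurable]: "(tlog :: complex ^ 'n \<Rightarrow> _) \<in> borel_measurable borel"
proof -
  have [measurable]: "(\<lambda>z :: complex ^ 'n. Im (z $ i)) \<in> borel_measurable borel" for i
    by (intro borel_measurable_continuous_onI continuous_intros)
  have [measurable]: "(\<lambda>z :: complex ^ 'n. arccos (max (-1) (min 1 (Re (z $ i))))) \<in> borel_measurable borel" for i
    by (intro borel_measurable_continuous_onI continuous_intros) auto
  show ?thesis
    by (subst borel_measurable_euclidean_space) (auto simp: tlog_def Basis_vec_def inner_axis)
qed

lemma solenoid_sigma_onto:
  assumes A: "int_matrix A" "invertible (transpose A)" and z: "z \<in> solenoid A"
  shows "inv_into (solenoid A) (sigma_map A) z \<in> solenoid A"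
proof (rule inv_into_into)
  have "(\<lambda>n. z (Suc n)) \<in> solenoid A" "sigma_map A (\<lambda>n. z (Suc n)) = z"
    using z by (auto simp: solenoid_def sigma_map_def fun_eq_iff split: nat.splits)
  then show "z \<in> sigma_map A ` solenoid A" by (metis imageI)
qed

lemma chi_in_solenoid:
  assumes A: "int_matrix A" "expansive A" and D: "D \<subseteq> int_vecs" and c: "is_cycle A D p l \<theta>"
  shows "chi p \<theta> \<in> solenoid A"
proof -
  have "torus_pow A (texp (\<theta> (Suc n mod p))) = texp (\<theta> (n mod p))" for n
  proof -
    have "tau A (l (n mod p)) (\<theta> (n mod p)) = \<theta> (Suc n mod p)" "l (n mod p) \<in> int_vecs"
      using c D by (auto simp: is_cycle_def mod_Suc_eq)
    then have "transpose A *v \<theta> (Suc n mod p) - \<theta> (n mod p) \<in> int_vecs"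
      unfolding tau_def by (metis matrix_inv_cancel(1)[OF expansive_invertible[OF A(2)]] add_diff_cancel_left')
    then show ?thesis by (simp add: torus_pow_texp[OF A(1)] texp_eq_iff)
  qed
  then show ?thesis by (simp add: solenoid_def chi_def)
qed

lemma sigma_inv_chi_in_solenoid:
  assumes A: "int_matrix A" "expansive A" and D: "D \<subseteq> int_vecs" and c: "is_cycle A D p l \<theta>"
  shows "(inv_into (solenoid A) (sigma_map A) ^^ j) (chi p \<theta>) \<in> solenoid A"
  by (induction j)
     (auto intro: chi_in_solenoid[OF assms] solenoid_sigma_onto[OF A(1) expansive_invertible[OF A(2)]])

lemma nn_integral_count_space_range:
  fixes h :: "nat \<Rightarrow> 'b"
  shows "(\<integral>\<^sup>+ s. F s \<partial>count_space (range h)) = (\<Sum>n. F (h n) * indicator {n. \<forall>m<n. h m \<noteq> h n} n)"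
proof -
  let ?N = "{n. \<forall>m<n. h m \<noteq> h n}"
  have "bij_betw h ?N (range h)"
  proof (rule bij_betw_imageI)
    show "inj_on h ?N" 
    proof (rule inj_onI)
      fix a b assume "a \<in> ?N" "b \<in> ?N" "h a = h b"
      then show "a = b" by (cases a b rule: linorder_cases) auto
    qed
    show "h ` ?N = range h"
    proof safe
      fix n
      define k where "k = (LEAST k. h k = h n)"
      have "h k = h n" unfolding k_def by (rule LeastI) simp
      moreover have "\<forall>m<k. h m \<noteq> h k" 

        using not_less_Least[of _ "\<lambda>k. h k = h n"] \<open>h k = h n\<close> by (simp add: k_def[symmetric])
      ultimately show "h n \<in> h ` ?N" by (intro image_eqI[of _ _ k]) auto
    qed auto
  qed
  from nn_integral_bij_count_space[OF this, of F]
  have "(\<integral>\<^sup>+ s. F s \<partial>count_space (range h)) = (\<integral>\<^sup>+ n. F (h n) \<partial>count_space ?N)" by simp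
  also have "\<dots> = (\<integral>\<^sup>+ n. F (h n) * indicator ?N n \<partial>count_space UNIV)"
    by (simp add: nn_integral_count_space_indicator)
  finally show ?thesis by (simp add: nn_integral_count_space_nat)
qed

lemma cycle_solenoid_fibres:
  fixes A :: "real ^ 'n ^ 'n"
  assumes A: "int_matrix A" "expansive A" and D: "D \<subseteq> int_vecs" and c: "is_cycle A D p l \<theta>"
  obtains h :: "nat \<Rightarrow> complex ^ 'n \<Rightarrow> nat \<Rightarrow> complex ^ 'n"
  where "\<And>k. h k \<in> borel_measurable borel"
    and "\<And>z. z \<in> torus \<Longrightarrow> {s \<in> cycle_solenoid A p \<theta>. s 0 = z} = range (\<lambda>k. h k z)"
proof -
  define B where "B = matrix_inv (transpose A)"
  define c where "c j = (inv_into (solenoid A) (sigma_map A) ^^ j) (chi p \<theta>)" for j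
  define I where "I = {..<p} \<times> (int_vecs :: (real ^ 'n) set)"
  define g where "g = (\<lambda>(j, k) z n. c j n * ihat A (tlog z - tlog (c j 0) + k) n)"
  have cj: "c j n \<in> torus" for j n
    using sigma_inv_chi_in_solenoid[OF assms, of j] by (auto simp: c_def solenoid_def)
  have "0 < p" using assms(4) by (simp add: is_cycle_def)
  then have "(0, 0) \<in> I" by (simp add: I_def)
  moreover have "countable I" by (simp add: I_def countable_int_vecs)
  ultimately have I: "range (from_nat_into I) = I" by (intro range_from_nat_into) auto
  have pow: "continuous_on UNIV ((*v) B ^^ n)" for n
  proof (induction n)
    case (Suc n)
    then show ?case
      by (auto simp: o_def intro: continuous_on_compose2[OF matrix_vector_mult_linear_continuous_on[of UNIV B]])
  qed (simp add: id_def continuous_on_id)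
  have "g i \<in> borel_measurable borel" for i
  proof (rule measurable_coordinatewise_then_product)
    fix n
    obtain j k where i: "i = (j, k)" by fastforce
    have [measurable]: "((*v) B ^^ n) \<in> borel_measurable borel"
      by (intro borel_measurable_continuous_onI pow)
    have "continuous_on UNIV (\<lambda>y. c j n * y)"
      unfolding times_vec_def by (intro continuous_intros)
    then have [measurable]: "(\<lambda>y. c j n * y) \<in> borel_measurable borel"
      by (rule borel_measurable_continuous_onI)
    show "(\<lambda>z. g i z n) \<in> borel_measurable borel"
      unfolding g_def i ihat_def B_def[symmetric] by simp
  qed
  moreover have "{s \<in> cycle_solenoid A p \<theta>. s 0 = z} = range (\<lambda>k. g (from_nat_into I k) z)"
    if z: "z \<in> torus" for z
  proof -
    have "{s \<in> cycle_solenoid A p \<theta>. s 0 = z} = (\<lambda>i. g i z) ` I"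
    proof (intro equalityI subsetI)
      fix s assume "s \<in> {s \<in> cycle_solenoid A p \<theta>. s 0 = z}"
      then obtain j x where jx: "j < p" "s = (\<lambda>n. c j n * ihat A x n)" "s 0 = z"
        by (auto simp: cycle_solenoid_def c_def)
      have "z = c j 0 * texp x" using jx by (simp add: ihat_def)
      then have "texp (tlog z) = texp (tlog (c j 0) + x)"
        using z cj by (simp add: texp_tlog texp_add)
      then have "- (tlog z - (tlog (c j 0) + x)) \<in> int_vecs"
        unfolding texp_eq_iff by (rule int_vecs_simps(2))
      moreover have "tlog z - tlog (c j 0) + (- (tlog z - (tlog (c j 0) + x))) = x" by simp
      ultimately show "s \<in> (\<lambda>i. g i z) ` I"
        using jx by (intro image_eqI[of _ _ "(j, - (tlog z - (tlog (c j 0) + x)))"]) (auto simp: g_def I_def)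
    next
      fix s assume "s \<in> (\<lambda>i. g i z) ` I"
      then obtain j k where jk: "j < p" "k \<in> int_vecs" "s = g (j, k) z" by (auto simp: I_def)
      have "s 0 = c j 0 * texp (tlog z - tlog (c j 0) + k)" by (simp add: jk g_def ihat_def)
      also have "\<dots> = texp (tlog (c j 0) + (tlog z - tlog (c j 0) + k))"
        using cj by (simp only: texp_add texp_tlog)
      also have "\<dots> = texp (tlog z)" using jk by (simp add: texp_eq_iff)
      finally have "s 0 = z" using z by (simp add: texp_tlog)
      then show "s \<in> {s \<in> cycle_solenoid A p \<theta>. s 0 = z}"
        using jk by (auto simp: cycle_solenoid_def g_def c_def)
    qed
    also have "\<dots> = (\<lambda>i. g i z) ` range (from_nat_into I)" by (simp add: I)
    finally show ?thesis by (simp add: image_image)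
  qed
  ultimately show ?thesis by (intro that[of "\<lambda>k. g (from_nat_into I k)"]) auto
qed

lemma sets_torus_haar: "sets torus_haar = sets (restrict_space borel torus)"
  and space_torus_haar: "space torus_haar = torus"
  by (auto simp: torus_haar_def space_restrict_space)

lemma fibre_sum_measurable:
  fixes A :: "real ^ 'n ^ 'n"
  assumes A: "int_matrix A" "expansive A" and D: "D \<subseteq> int_vecs" and c: "is_cycle A D p l \<theta>"
    and F: "F \<in> borel_measurable (restrict_space borel (cycle_solenoid A p \<theta>))"
  shows "(\<lambda>z. \<integral>\<^sup>+ s. F s \<partial>count_space {s \<in> cycle_solenoid A p \<theta>. s 0 = z}) \<in> borel_measurable torus_haar"
proof -
  obtain h :: "nat \<Rightarrow> complex ^ 'n \<Rightarrow> nat \<Rightarrow> complex ^ 'n"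
    where h [measurable]: "\<And>k. h k \<in> borel_measurable borel"
    and fib: "\<And>z. z \<in> torus \<Longrightarrow> {s \<in> cycle_solenoid A p \<theta>. s 0 = z} = range (\<lambda>k. h k z)"
    using cycle_solenoid_fibres[OF A D c] by blast
  have hS: "h k z \<in> cycle_solenoid A p \<theta>" if "z \<in> torus" for k z
    using fib[OF that] by blast
  have h' [measurable]: "h k \<in> borel_measurable (restrict_space borel torus)" for k
    by (intro measurable_restrict_space1) simp
  have [measurable]: "(\<lambda>z. F (h k z)) \<in> borel_measurable (restrict_space borel torus)" for k
    by (rule measurable_compose[OF measurable_restrict_space3[OF h] F]) (use hS in auto)
  have hn [measurable]: "(\<lambda>z. h k z n) \<in> borel_measurable (restrict_space borel torus)" for k n
    by (rule measurable_product_then_coordinatewise[OF h'])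
  have [measurable]: "Measurable.pred (restrict_space borel torus) (\<lambda>z. h m z = h k z)" for m k
    unfolding fun_eq_iff
    by (intro pred_intros_countable) (unfold pred_def, rule measurable_equality_set[OF hn hn])
  have "(\<lambda>z. \<Sum>k. F (h k z) * indicator {n. \<forall>m<n. h m z \<noteq> h n z} k)
      \<in> borel_measurable (restrict_space borel torus)"
    unfolding indicator_def mem_Collect_eq by measurable
  then have "(\<lambda>z. \<integral>\<^sup>+ s. F s \<partial>count_space {s \<in> cycle_solenoid A p \<theta>. s 0 = z})
      \<in> borel_measurable (restrict_space borel torus)"
    by (subst measurable_cong[where g = "\<lambda>z. \<Sum>k. F (h k z) * indicator {n. \<forall>m<n. h m z \<noteq> h n z} k"])
       (auto simp: space_restrict_space fib nn_integral_count_space_range)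
  then show ?thesis by (simp add: measurable_cong_sets[OF sets_torus_haar refl])
qed

lemma sets_mu_tilde: "sets (mu_tilde A p \<theta>) = sets (restrict_space borel (cycle_solenoid A p \<theta>))"
  and space_mu_tilde: "space (mu_tilde A p \<theta>) = cycle_solenoid A p \<theta>"
proof -
  let ?R = "restrict_space borel (cycle_solenoid A p \<theta>)"
  have sp: "space ?R = cycle_solenoid A p \<theta>" by (simp add: space_restrict_space)
  have cl: "sets ?R \<subseteq> Pow (cycle_solenoid A p \<theta>)"
    using sets.space_closed[of ?R] unfolding sp .
  show "sets (mu_tilde A p \<theta>) = sets ?R"
    unfolding mu_tilde_def sets_measure_of[OF cl] using sets.sigma_sets_eq[of ?R] unfolding sp .
  show "space (mu_tilde A p \<theta>) = cycle_solenoid A p \<theta>"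
    unfolding mu_tilde_def by (rule space_measure_of[OF cl])
qed

lemma emeasure_mu_tilde:
  assumes A: "int_matrix A" "expansive A" and D: "D \<subseteq> int_vecs" and c: "is_cycle A D p l \<theta>"
    and E: "E \<in> sets (restrict_space borel (cycle_solenoid A p \<theta>))"
  shows "emeasure (mu_tilde A p \<theta>) E =
    (\<integral>\<^sup>+ z. (\<integral>\<^sup>+ s. indicator E s \<partial>count_space {s \<in> cycle_solenoid A p \<theta>. s 0 = z}) \<partial>torus_haar)"
  unfolding mu_tilde_def
proof (rule emeasure_measure_of_sigma)
  let ?R = "restrict_space borel (cycle_solenoid A p \<theta>)"
  let ?m = "\<lambda>E. \<integral>\<^sup>+ z. (\<integral>\<^sup>+ s. indicator E s \<partial>count_space {s \<in> cycle_solenoid A p \<theta>. s 0 = z}) \<partial>torus_haar"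
  show "sigma_algebra (cycle_solenoid A p \<theta>) (sets ?R)"
    using sets.sigma_algebra_axioms[of ?R] by (simp add: space_restrict_space)
  show "positive (sets ?R) ?m" by (simp add: positive_def)
  show "countably_additive (sets ?R) ?m"
  proof (rule countably_additiveI)
    fix E :: "nat \<Rightarrow> _" assume E: "range E \<subseteq> sets ?R" "disjoint_family E" "(\<Union>i. E i) \<in> sets ?R"
    have "(\<Sum>i. ?m (E i)) =
        (\<integral>\<^sup>+ z. (\<Sum>i. \<integral>\<^sup>+ s. indicator (E i) s \<partial>count_space {s \<in> cycle_solenoid A p \<theta>. s 0 = z}) \<partial>torus_haar)"
      using E by (intro nn_integral_suminf[symmetric] fibre_sum_measurable[OF A D c] borel_measurable_indicator) auto
    also have "\<dots> = (\<integral>\<^sup>+ z. (\<integral>\<^sup>+ s. (\<Sum>i. indicator (E i) s) \<partial>count_space {s \<in> cycle_solenoid A p \<theta>. s 0 = z}) \<partial>torus_haar)"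
      by (simp add: nn_integral_suminf)
    finally show "(\<Sum>i. ?m (E i)) = ?m (\<Union>i. E i)"
      by (simp add: suminf_indicator[OF E(2)])
  qed
qed (fact E)

lemma nn_integral_mu_tilde:
  assumes A: "int_matrix A" "expansive A" and D: "D \<subseteq> int_vecs" and c: "is_cycle A D p l \<theta>"
    and F: "F \<in> borel_measurable (restrict_space borel (cycle_solenoid A p \<theta>))"
  shows "(\<integral>\<^sup>+ s. F s \<partial>mu_tilde A p \<theta>) =
    (\<integral>\<^sup>+ z. (\<integral>\<^sup>+ s. F s \<partial>count_space {s \<in> cycle_solenoid A p \<theta>. s 0 = z}) \<partial>torus_haar)"
proof -
  let ?S = "cycle_solenoid A p \<theta>"
  let ?R = "restrict_space borel ?S"
  have me: "borel_measurable (mu_tilde A p \<theta>) = borel_measurable ?R"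
    by (rule measurable_cong_sets) (auto simp: sets_mu_tilde)
  note meas = fibre_sum_measurable[OF A D c]
  have sp: "space ?R = ?S" by (simp add: space_restrict_space)
  from F show ?thesis
  proof (induction rule: borel_measurable_induct)
    case (cong f g)
    have "(\<integral>\<^sup>+ s. f s \<partial>mu_tilde A p \<theta>) = (\<integral>\<^sup>+ s. g s \<partial>mu_tilde A p \<theta>)"
      using cong by (intro nn_integral_cong) (auto simp: space_mu_tilde space_restrict_space)
    moreover have "(\<integral>\<^sup>+ s. f s \<partial>count_space {s \<in> ?S. s 0 = z}) = (\<integral>\<^sup>+ s. g s \<partial>count_space {s \<in> ?S. s 0 = z})" for z
      using cong by (intro nn_integral_cong) (auto simp: space_restrict_space)
    ultimately show ?case using cong by simp
  next
    case (set E)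
    then show ?case
      by (simp add: nn_integral_indicator sets_mu_tilde emeasure_mu_tilde[OF A D c])
  next
    case (mult u c)
    then show ?case
      using meas[OF mult(2)] by (simp add: nn_integral_cmult me)
  next
    case (add u v)
    then show ?case
      using meas[OF add(1)] meas[OF add(3)] by (simp add: nn_integral_add me)
  next
    case (seq U)
    have "(\<integral>\<^sup>+ s. (SUP i. U i) s \<partial>mu_tilde A p \<theta>) = (SUP i. \<integral>\<^sup>+ s. U i s \<partial>mu_tilde A p \<theta>)"
      using seq by (simp add: nn_integral_monotone_convergence_SUP me image_image)
    also have "\<dots> = (SUP i. \<integral>\<^sup>+ z. (\<integral>\<^sup>+ s. U i s \<partial>count_space {s \<in> ?S. s 0 = z}) \<partial>torus_haar)"
      using seq by simp
    also have "\<dots> = (\<integral>\<^sup>+ z. (SUP i. \<integral>\<^sup>+ s. U i s \<partial>count_space {s \<in> ?S. s 0 = z}) \<partial>torus_haar)"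
    proof (rule nn_integral_monotone_convergence_SUP[symmetric])
      show "incseq (\<lambda>i z. \<integral>\<^sup>+ s. U i s \<partial>count_space {s \<in> ?S. s 0 = z})"
        using seq(3) by (auto intro!: nn_integral_mono simp: incseq_def le_fun_def)
    qed (use seq meas in auto)
    also have "\<dots> = (\<integral>\<^sup>+ z. (\<integral>\<^sup>+ s. (SUP i. U i s) \<partial>count_space {s \<in> ?S. s 0 = z}) \<partial>torus_haar)"
      using seq by (intro nn_integral_cong nn_integral_monotone_convergence_SUP[symmetric]) auto
    finally show ?case by (simp add: image_image)
  qed
qed

lemma cbox_cube_measurable [measurable]: "{x :: real ^ 'n. \<forall>i. 0 \<le> x $ i \<and> x $ i < 1} \<in> sets borel"
proof -
  have [measurable]: "(\<lambda>x :: real ^ 'n. x $ i) \<in> borel_measurable borel" for i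
    by (intro borel_measurable_continuous_onI continuous_intros)
  show ?thesis by measurable
qed

lemma cube_translate_ex1:
  fixes x :: "real ^ 'n"
  shows "\<exists>!k. k \<in> int_vecs \<and> x - k \<in> {x. \<forall>i. 0 \<le> x $ i \<and> x $ i < 1}"
proof (rule ex1I[of _ "\<chi> i. of_int \<lfloor>x $ i\<rfloor>"])
  show "(\<chi> i. of_int \<lfloor>x $ i\<rfloor>) \<in> int_vecs \<and> x - (\<chi> i. of_int \<lfloor>x $ i\<rfloor>) \<in> {x. \<forall>i. 0 \<le> x $ i \<and> x $ i < 1}"
    by (auto simp: int_vecs_def) linarith
next
  fix k assume k: "k \<in> int_vecs \<and> x - k \<in> {x. \<forall>i. 0 \<le> x $ i \<and> x $ i < 1}"
  have "k $ i = of_int \<lfloor>x $ i\<rfloor>" for i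
  proof -
    from k obtain n where n: "k $ i = of_int n" by (auto simp: int_vecs_def Ints_def)
    moreover have "0 \<le> x $ i - k $ i" "x $ i - k $ i < 1" using k by auto
    ultimately have "\<lfloor>x $ i\<rfloor> = n" by linarith
    then show ?thesis using n by simp
  qed
  then show "k = (\<chi> i. of_int \<lfloor>x $ i\<rfloor>)" by (simp add: vec_eq_iff)
qed

lemma emeasure_lborel_plus:
  fixes c :: "'a :: euclidean_space"
  assumes "B \<in> sets borel"
  shows "emeasure lborel {x. c + x \<in> B} = emeasure lborel B"
proof -
  have "emeasure lborel B = emeasure (distr lborel borel ((+) c)) B" by (simp add: lborel_distr_plus)
  also have "\<dots> = emeasure lborel {x. c + x \<in> B}"
    using assms by (simp add: emeasure_distr vimage_def)
  finally show ?thesis ..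
qed

lemma emeasure_torus_haar:
  assumes "E \<in> sets borel" "E \<subseteq> torus"
  shows "emeasure torus_haar E = emeasure lborel {x. (\<forall>i. 0 \<le> x $ i \<and> x $ i < 1) \<and> texp x \<in> E}"
proof -
  let ?Q = "{x :: real ^ 'a. \<forall>i. 0 \<le> x $ i \<and> x $ i < 1}"
  have m: "texp \<in> measurable (restrict_space lborel ?Q) (restrict_space borel torus)"
    by (rule measurable_restrict_space2) (auto intro: measurable_restrict_space1)
  have "E \<in> sets (restrict_space borel torus)" using assms by (auto simp: sets_restrict_space)
  then have "emeasure torus_haar E = emeasure (restrict_space lborel ?Q) (texp -` E \<inter> ?Q)"
    unfolding torus_haar_def by (subst emeasure_distr[OF m]) (auto simp: space_restrict_space)
  also have "\<dots> = emeasure lborel (texp -` E \<inter> ?Q)"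
    by (rule emeasure_restrict_space) auto
  also have "texp -` E \<inter> ?Q = {x. (\<forall>i. 0 \<le> x $ i \<and> x $ i < 1) \<and> texp x \<in> E}" by auto
  finally show ?thesis .
qed

lemma torus_haar_prob: "emeasure (torus_haar :: (complex ^ 'n) measure) torus = 1"
proof -
  have cl: "closed (torus :: (complex ^ 'n) set)"
    unfolding torus_def by (intro closed_Collect_all closed_Collect_eq continuous_intros)
  have "box 0 (\<chi> i. 1) \<subseteq> {x :: real ^ 'n. \<forall>i. 0 \<le> x $ i \<and> x $ i < 1}"
    by (auto simp: mem_box_cart less_imp_le)
  then have "emeasure lborel (box 0 (\<chi> i. 1) :: (real ^ 'n) set) \<le> emeasure lborel {x :: real ^ 'n. \<forall>i. 0 \<le> x $ i \<and> x $ i < 1}"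
    by (rule emeasure_mono) simp
  moreover have "{x :: real ^ 'n. \<forall>i. 0 \<le> x $ i \<and> x $ i < 1} \<subseteq> cbox 0 (\<chi> i. 1)"
    by (auto simp: mem_box_cart less_imp_le)
  then have "emeasure lborel {x :: real ^ 'n. \<forall>i. 0 \<le> x $ i \<and> x $ i < 1} \<le> emeasure lborel (cbox 0 (\<chi> i. 1) :: (real ^ 'n) set)"
    by (rule emeasure_mono) simp
  moreover have "emeasure lborel (cbox 0 (\<chi> i. 1) :: (real ^ 'n) set) = 1"
    by (auto simp: emeasure_lborel_cbox_eq Basis_vec_def inner_axis intro!: prod.neutral)
  moreover have "emeasure lborel (box 0 (\<chi> i. 1) :: (real ^ 'n) set) = 1"
    by (auto simp: emeasure_lborel_box_eq Basis_vec_def inner_axis intro!: prod.neutral)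
  ultimately show ?thesis
    using cl by (subst emeasure_torus_haar) (auto intro: borel_closed)
qed

lemma torus_haar_invariant:
  fixes w :: "complex ^ 'n"
  assumes E: "E \<in> sets borel" "E \<subseteq> torus" and w: "w \<in> torus"
  shows "emeasure torus_haar {z \<in> torus. w * z \<in> E} = emeasure torus_haar E"
proof -
  define Q where "Q = {x :: real ^ 'n. \<forall>i. 0 \<le> x $ i \<and> x $ i < 1}"
  define P where "P = {x :: real ^ 'n. texp x \<in> E}"
  define a where "a = tlog w"
  define A where "A k = {y. - a + y \<in> Q \<and> - k + y \<in> Q \<and> y \<in> P}" for k
  define B where "B k = {y. k + (- a + y) \<in> Q \<and> y \<in> Q \<and> y \<in> P}" for k
  have wa: "texp a = w" using w by (simp add: a_def texp_tlog)
  have [measurable]: "Q \<in> sets borel" unfolding Q_def by simp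
  have [measurable]: "P \<in> sets borel"
    using measurable_sets[OF texp_measurable E(1)] by (simp add: P_def vimage_def)
  have Pper: "k + y \<in> P \<longleftrightarrow> y \<in> P" if "k \<in> int_vecs" for k y
  proof -
    have "texp (k + y) = texp y" using that by (simp add: texp_eq_iff)
    then show ?thesis by (simp add: P_def)
  qed
  have meas [measurable]: "A k \<in> sets borel" "B k \<in> sets borel" for k
    unfolding A_def B_def by measurable
  have uniq: "\<exists>!k. k \<in> int_vecs \<and> x - k \<in> Q" for x
    unfolding Q_def by (rule cube_translate_ex1)
  have cl: "closed (torus :: (complex ^ 'n) set)"
    unfolding torus_def by (intro closed_Collect_all closed_Collect_eq continuous_intros)
  have "continuous_on UNIV (\<lambda>z. w * z)" unfolding times_vec_def by (intro continuous_intros)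
  then have "(\<lambda>z. w * z) \<in> borel_measurable borel" by (rule borel_measurable_continuous_onI)
  from measurable_sets[OF this E(1)] have "{z. w * z \<in> E} \<in> sets borel" by (simp add: vimage_def)
  then have wE: "{z \<in> torus. w * z \<in> E} \<in> sets borel"
    using cl by (simp add: Collect_conj_eq borel_closed)
  have "emeasure torus_haar {z \<in> torus. w * z \<in> E} = emeasure lborel {x. x \<in> Q \<and> a + x \<in> P}"
    using wE by (subst emeasure_torus_haar) (auto simp: Q_def P_def texp_add wa)
  also have "\<dots> = emeasure lborel {x. a + x \<in> {y. - a + y \<in> Q \<and> y \<in> P}}" by simp
  also have "\<dots> = emeasure lborel {y. - a + y \<in> Q \<and> y \<in> P}"
    by (rule emeasure_lborel_plus) measurable
  also have "{y. - a + y \<in> Q \<and> y \<in> P} = (\<Union>k \<in> int_vecs. A k)"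
    using uniq by (fastforce simp: A_def)
  also have "emeasure lborel \<dots> = (\<integral>\<^sup>+ k. emeasure lborel (A k) \<partial>count_space int_vecs)"
  proof (rule emeasure_UN_countable)
    show "disjoint_family_on A int_vecs"
      using uniq by (fastforce simp: disjoint_family_on_def A_def)
  qed (auto simp: countable_int_vecs)
  also have "\<dots> = (\<integral>\<^sup>+ k. emeasure lborel (B k) \<partial>count_space int_vecs)"
  proof (rule nn_integral_cong)
    fix k :: "real ^ 'n" assume "k \<in> space (count_space int_vecs)"
    then have "k \<in> int_vecs" by simp
    moreover have "- a + (k + y) = k + (- a + y)" "- k + (k + y) = y" for y :: "real ^ 'n" by simp_all
    ultimately have "B k = {y. k + y \<in> A k}" by (simp only: A_def B_def Pper mem_Collect_eq)
    then show "emeasure lborel (A k) = emeasure lborel (B k)"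
      using emeasure_lborel_plus[of "A k" k] by simp
  qed
  also have "\<dots> = emeasure lborel (\<Union>k \<in> int_vecs. B k)"
  proof (rule emeasure_UN_countable[symmetric])
    show "disjoint_family_on B int_vecs"
    proof (unfold disjoint_family_on_def, safe)
      fix k k' y assume "k \<in> int_vecs" "k' \<in> int_vecs" "k \<noteq> k'" "y \<in> B k" "y \<in> B k'"
      then have "- k \<in> int_vecs \<and> (- a + y) - (- k) \<in> Q" "- k' \<in> int_vecs \<and> (- a + y) - (- k') \<in> Q"
        by (auto simp: B_def algebra_simps)
      then have "- k = - k'" using uniq[of "- a + y"] by blast
      then show "y \<in> {}" using \<open>k \<noteq> k'\<close> by simp
    qed
  qed (auto simp: countable_int_vecs)
  also have "(\<Union>k \<in> int_vecs. B k) = {x. x \<in> Q \<and> x \<in> P}"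
  proof -
    have "\<exists>k \<in> int_vecs. k + (- a + y) \<in> Q" for y
    proof -
      obtain k where "k \<in> int_vecs" "(- a + y) - k \<in> Q" using uniq[of "- a + y"] by blast
      then show ?thesis by (intro bexI[of _ "- k"]) (auto simp: algebra_simps)
    qed
    then show ?thesis by (auto simp: B_def)
  qed
  also have "emeasure lborel \<dots> = emeasure torus_haar E"
    using E by (subst emeasure_torus_haar) (auto simp: Q_def P_def)
  finally show ?thesis .
qed

end

theory Submission
  imports Defs "HOL-Computational_Algebra.Fundamental_Theorem_Algebra"
begin

text \<open>
  Write \<open>B\<close> for the transpose of \<open>A\<close> and \<open>M\<close> for its inverse.  Acting by a word gives
  \<open>M\<^sup>n (x + \<Sum>\<^sub>i B\<^sup>i \<omega>\<^sub>i)\<close> with \<open>i < n\<close>, so if \<open>encode\<close> of \<open>(x, \<omega>)\<close> equals \<open>ihat_cycle\<close> of \<open>(x', j)\<close>, the zeroth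
  coordinate says \<open>x' = x - \<theta>\<^sub>j + k\<close> with an integer vector \<open>k\<close>, and the remaining ones say that
  \<open>M\<^sup>n (k - \<theta>\<^sub>j - \<Sum>\<^sub>i B\<^sup>i \<omega>\<^sub>i)\<close> is congruent to \<open>- \<theta>\<^sub>n\<^sub>+\<^sub>j\<close> for every \<open>n\<close>.  That condition does not involve \<open>x\<close>, and
  it holds exactly if \<open>\<omega>\<close> is the digit sequence of the backward orbit of \<open>k - \<theta>\<^sub>j\<close>
  (\<open>encode_eq_ihat_cycle_iff\<close>).  Consequently, once \<open>ihat_cycle\<close> is used as a coordinate system,
  \<open>encode\<close> is the map \<open>(x, \<omega>(k, j)) \<mapsto> (x - \<theta>\<^sub>j + k, j)\<close>, and three things remain.

  First, \<open>ihat_cycle\<close> is bijective (\<open>bij_betw_ihat_cycle\<close>).  Injectivity follows from \<open>M\<^sup>n \<rightarrow> 0\<close>: the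
  Euclidean part disappears along the sequence and leaves the cycle points, which are distinct
  modulo integer vectors; the difference of the Euclidean parts is then integral at each stage and
  tends to zero.

  Second, the words \<open>\<omega>(k, j)\<close> are exactly those of \<open>\<Omega>\<^sub>C\<close>, the set \<open>Omega_tilde\<close>.  The backward orbit moves by a contraction in
  the discrete set of integer translates of the cycle, so it is eventually periodic, and its
  periodic part is the negative of a cycle (\<open>omega_of_in_Omega_tilde\<close>).  Conversely, a word of \<open>\<Omega>\<^sub>C\<close>
  has a tail with a fixed point congruent to some \<open>\<theta>\<^sub>j\<close>.  Two solenoid elements that agree at
  arbitrarily late coordinates are equal, which identifies the code of the fixed point with that of
  the cycle and produces \<open>j_of\<close> and \<open>k_of\<close> (\<open>j_of_k_of\<close>).

  Third, by the tiling condition almost every point is \<open>y + k\<close> for exactly one \<open>y\<close> in the attractor and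
  one integer vector \<open>k\<close>.  The exceptional set is invariant under integer translations, so it is
  visible in the zeroth coordinate alone, and it is a Borel set because the attractor is compact; it
  therefore gives null sets for all the measures concerned.

  The analytic input is that \<open>\<Sum> \<parallel>M\<^sup>n\<parallel>\<close> converges
  (\<open>expansive_transpose_inverse_powers_bound\<close>).  It is obtained vector by vector, from a polynomial
  that annihilates the vector, by removing one root at a time.
\<close>

section \<open>Powers of the inverse of an expansive matrix are summable\<close>

(* The simplifier would rewrite transpose A *v x to x v* A; all arguments below treat
   the transpose as an operator in its own right. *)
declare transpose_matrix_vector [simp del]

text \<open>This is \<open>P(T) v\<close>.  Keeping \<open>v\<close> as an argument avoids an algebra of matrix polynomials.\<close>

definition poly_act :: "complex ^ 'n ^ 'n \<Rightarrow> complex poly \<Rightarrow> complex ^ 'n \<Rightarrow> complex ^ 'n" where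
  "poly_act T P v = (\<Sum>i\<le>degree P. coeff P i *s ((*v) T ^^ i) v)"

lemma poly_act_eq:
  assumes "degree P \<le> N"
  shows "poly_act T P v = (\<Sum>i\<le>N. coeff P i *s ((*v) T ^^ i) v)"
  unfolding poly_act_def
  by (rule sum.mono_neutral_left) (use assms in \<open>auto simp: coeff_eq_0\<close>)

lemma funpow_matrix_add:
  fixes T :: "'a::semiring_1 ^ 'n ^ 'n"
  shows "((*v) T ^^ n) (u + v) = ((*v) T ^^ n) u + ((*v) T ^^ n) v"
  by (induction n) (auto simp: matrix_vector_right_distrib)

lemma funpow_matrix_diff:
  fixes T :: "'a::ring_1 ^ 'n ^ 'n"
  shows "((*v) T ^^ n) (u - v) = ((*v) T ^^ n) u - ((*v) T ^^ n) v"
  by (induction n) (auto simp: matrix_vector_mult_diff_distrib)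

lemma funpow_matrix_cmult:
  fixes T :: "'a::field ^ 'n ^ 'n"
  shows "((*v) T ^^ n) (c *s v) = c *s ((*v) T ^^ n) v"
  by (induction n) (auto simp: vector_scalar_commute)

text \<open>Composing with a linear factor moves the factor onto the vector; this is what lets a root be
  split off an annihilating polynomial of \<open>v\<close> at the cost of replacing \<open>v\<close> by \<open>T v - r v\<close>.\<close>

lemma poly_act_linear_factor:
  "poly_act T ([:- r, 1:] * Q) v = poly_act T Q (T *v v - r *s v)"
proof -
  define N where "N = degree Q"
  let ?f = "\<lambda>i. ((*v) T ^^ i) v"
  have "degree ([:- r, 1:] * Q) \<le> Suc N"
    unfolding N_def by (rule order_trans[OF degree_mult_le]) simp
  then have "poly_act T ([:- r, 1:] * Q) v = (\<Sum>i\<le>Suc N. coeff ([:- r, 1:] * Q) i *s ?f i)"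
    by (rule poly_act_eq)
  also have "\<dots> = (\<Sum>i\<le>Suc N. coeff (pCons 0 Q) i *s ?f i) - (\<Sum>i\<le>Suc N. (r * coeff Q i) *s ?f i)"
    by (simp add: mult_pCons_left algebra_simps vector_sadd_rdistrib vector_ssub_ldistrib
        flip: sum_subtractf sum.distrib)
  also have "(\<Sum>i\<le>Suc N. coeff (pCons 0 Q) i *s ?f i) = (\<Sum>i\<le>N. coeff Q i *s ?f (Suc i))"
    by (subst sum.atMost_Suc_shift) simp
  also have "(\<Sum>i\<le>Suc N. (r * coeff Q i) *s ?f i) = (\<Sum>i\<le>N. (r * coeff Q i) *s ?f i)"
    by (simp add: N_def coeff_eq_0)
  also have "(\<Sum>i\<le>N. coeff Q i *s ?f (Suc i)) - (\<Sum>i\<le>N. (r * coeff Q i) *s ?f i)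
      = (\<Sum>i\<le>N. coeff Q i *s ((*v) T ^^ i) (T *v v - r *s v))"
    by (simp add: funpow_matrix_diff funpow_matrix_cmult funpow_swap1 vector_ssub_ldistrib
        vector_smult_assoc mult.commute flip: sum_subtractf)
  finally show ?thesis by (simp add: poly_act_def N_def)
qed

lemma poly_act_commute:
  "poly_act T Q (T *v v - r *s v) = T *v poly_act T Q v - r *s poly_act T Q v"
proof -
  have "T *v (\<Sum>i\<le>degree Q. coeff Q i *s ((*v) T ^^ i) v) = (\<Sum>i\<le>degree Q. coeff Q i *s (T *v ((*v) T ^^ i) v))"
    by (simp add: vec.linear_sum[OF matrix_vector_mul_linear_gen] vector_scalar_commute)
  then show ?thesis
    by (simp add: poly_act_def funpow_matrix_diff funpow_matrix_cmult funpow_swap1 vector_ssub_ldistrib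
        vector_smult_assoc mult.commute sum_subtractf vec.scale_sum_right)
qed

text \<open>Summing the recurrence bounds a partial sum \<open>s\<close> of \<open>a\<close> by \<open>a 0 + r s + \<Sum> b\<close>, and \<open>r < 1\<close> allows
  \<open>r s\<close> to be absorbed on the left.\<close>

lemma summable_contraction_recurrence:
  fixes a b :: "nat \<Rightarrow> real"
  assumes r: "0 \<le> r" "r < 1" and a: "\<And>n. 0 \<le> a n" and b: "\<And>n. 0 \<le> b n" "summable b"
    and rec: "\<And>n. a (Suc n) \<le> r * a n + b n"
  shows "summable a"
proof (rule summableI_nonneg_bounded)
  define K where "K = (a 0 + suminf b) / (1 - r)"
  fix n
  have "sum a {..<n} \<le> a 0 + r * sum a {..<n} + suminf b"
  proof (cases n)
    case (Suc m)
    have "sum a {..<n} = a 0 + (\<Sum>i<m. a (Suc i))"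
      unfolding Suc by (rule sum.lessThan_Suc_shift)
    also have "\<dots> \<le> a 0 + (\<Sum>i<m. r * a i + b i)"
      by (intro add_left_mono sum_mono rec)
    also have "\<dots> = a 0 + r * sum a {..<m} + sum b {..<m}"
      by (simp add: sum.distrib sum_distrib_left)
    also have "\<dots> \<le> a 0 + r * sum a {..<n} + suminf b"
      using r a b sum_le_suminf[of b "{..<m}"] Suc
      by (intro add_mono mult_left_mono) auto
    finally show ?thesis .
  qed (use a b in \<open>auto intro: suminf_nonneg add_nonneg_nonneg\<close>)
  then have "(1 - r) * sum a {..<n} \<le> a 0 + suminf b" by (simp add: algebra_simps)
  then show "sum a {..<n} \<le> K" using r by (simp add: K_def field_simps)
qed (rule a)

text \<open>Induction on the degree of the annihilating polynomial.  Split off a root \<open>r\<close>.  If \<open>\<bar>r\<bar> < 1\<close>, the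
  shorter polynomial annihilates \<open>w = T v - r v\<close>, and the iterates of \<open>v\<close> satisfy a contractive
  recurrence with the summable perturbation \<open>T\<^sup>n w\<close>.  Otherwise \<open>r\<close> is not an eigenvalue, so
  \<open>T - r\<close> is injective and the shorter polynomial annihilates \<open>v\<close> itself.  This gives the
  decay that the spectral radius predicts without a normal form for \<open>T\<close>.\<close>

lemma summable_norm_iterates_of_annihilated:
  fixes T :: "complex ^ 'n ^ 'n"
  assumes eig: "\<And>r u. T *v u = r *s u \<Longrightarrow> u \<noteq> 0 \<Longrightarrow> cmod r < 1"
    and P: "P \<noteq> 0" "poly_act T P v = 0"
  shows "summable (\<lambda>n. norm (((*v) T ^^ n) v))"
  using P
proof (induction "degree P" arbitrary: P v)
  case 0
  then obtain c where "P = [:c:]" "c \<noteq> 0" by (metis degree_eq_zeroE pCons_0_0)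
  then have "v = 0" using 0 by (simp add: poly_act_def)
  moreover have "((*v) T ^^ n) 0 = 0" for n by (induction n) auto
  ultimately show ?case by simp
next
  case (Suc d)
  obtain r where "poly P r = 0"
    using alg_closed_imp_poly_has_root[of P] Suc.hyps(2) by auto
  then obtain Q where Q: "P = [:- r, 1:] * Q" by (metis poly_eq_0_iff_dvd dvd_def)
  have "Q \<noteq> 0" using Q Suc.prems(1) by auto
  have dQ: "degree Q = d"
    using Suc.hyps(2) \<open>Q \<noteq> 0\<close> unfolding Q by (subst (asm) degree_mult_eq) auto
  define w where "w = T *v v - r *s v"
  have "poly_act T Q w = 0"
    using Suc.prems(2) unfolding Q w_def by (simp only: poly_act_linear_factor)
  with Suc.hyps(1)[of Q w] dQ \<open>Q \<noteq> 0\<close> have w: "summable (\<lambda>n. norm (((*v) T ^^ n) w))" by simp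
  show ?case
  proof (cases "cmod r < 1")
    case True
    show ?thesis
    proof (rule summable_contraction_recurrence[OF norm_ge_zero True norm_ge_zero norm_ge_zero w])
      fix n
      have "T *v v = r *s v + w" by (simp add: w_def)
      then have "((*v) T ^^ Suc n) v = r *s ((*v) T ^^ n) v + ((*v) T ^^ n) w"
        by (simp add: funpow_Suc_right funpow_matrix_add funpow_matrix_cmult del: funpow.simps)
      moreover have "norm (r *s ((*v) T ^^ n) v) = cmod r * norm (((*v) T ^^ n) v)"
        by (simp add: norm_vec_def L2_set_def norm_mult power_mult_distrib real_sqrt_mult
            flip: sum_distrib_left)
      ultimately show "norm (((*v) T ^^ Suc n) v) \<le> cmod r * norm (((*v) T ^^ n) v) + norm (((*v) T ^^ n) w)"
        by (metis norm_triangle_ineq)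
    qed
  next
    case False
    have "T *v poly_act T Q v = r *s poly_act T Q v"
      using \<open>poly_act T Q w = 0\<close> by (simp add: w_def poly_act_commute)
    then have "poly_act T Q v = 0" using eig False by blast
    then show ?thesis using Suc.hyps(1) dQ \<open>Q \<noteq> 0\<close> by blast
  qed
qed

text \<open>Applied to the iterates of a vector under a matrix, this yields an annihilating polynomial.  The
  case of a repeated member is separate because it leaves too few distinct vectors to count.\<close>

lemma sequence_linearly_dependent:
  fixes f :: "nat \<Rightarrow> 'a::euclidean_space"
  obtains N :: nat and c :: "nat \<Rightarrow> real" where "\<exists>i\<le>N. c i \<noteq> 0" "(\<Sum>i\<le>N. c i *\<^sub>R f i) = 0"
proof (cases "inj_on f {..DIM('a)}")
  case True
  then have "card (f ` {..DIM('a)}) > dim (f ` {..DIM('a)})"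
    using dim_subset_UNIV[of "f ` {..DIM('a)}"] by (simp add: card_image)
  then have "dependent (f ` {..DIM('a)})" by (rule dependent_biggerset_general) 
  then obtain u where u: "\<exists>v\<in>f ` {..DIM('a)}. u v \<noteq> 0" "(\<Sum>v\<in>f ` {..DIM('a)}. u v *\<^sub>R v) = 0"
    by (subst (asm) dependent_finite) auto
  from u(2) have "(\<Sum>i\<le>DIM('a). u (f i) *\<^sub>R f i) = 0"
    by (simp add: sum.reindex[OF True])
  then show ?thesis using u(1) by (intro that[of "DIM('a)" "u \<circ> f"]) auto
next
  case False
  then obtain i j where ij: "i \<le> DIM('a)" "j \<le> DIM('a)" "i \<noteq> j" "f i = f j"
    by (auto simp: inj_on_def)
  define c where "c k = (if k = i then 1 else 0) - (if k = j then 1 else 0 :: real)" for k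
  have "(\<Sum>k\<le>DIM('a). c k *\<^sub>R f k) = 0"
    using ij by (simp add: c_def scaleR_left_diff_distrib sum_subtractf if_distrib[of "\<lambda>r. r *\<^sub>R _"] cong: if_cong)
  moreover have "c i \<noteq> 0" using ij by (simp add: c_def)
  ultimately show ?thesis using ij by (intro that[of "DIM('a)" c]) auto
qed

definition complex_vec :: "real ^ 'n \<Rightarrow> complex ^ 'n" where
  "complex_vec x = (\<chi> i. complex_of_real (x $ i))"

definition complex_matrix :: "real ^ 'n ^ 'n \<Rightarrow> complex ^ 'n ^ 'n" where
  "complex_matrix A = (\<chi> i j. complex_of_real (A $ i $ j))"

lemma complex_matrix_vec: "complex_matrix A *v complex_vec x = complex_vec (A *v x)"
  by (simp add: complex_matrix_def complex_vec_def matrix_vector_mult_def vec_eq_iff)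

lemma complex_matrix_mult: "complex_matrix A ** complex_matrix B = complex_matrix (A ** B)"
  by (simp add: complex_matrix_def matrix_matrix_mult_def vec_eq_iff)

lemma complex_matrix_one: "complex_matrix (mat 1) = mat 1"
  by (simp add: complex_matrix_def mat_def vec_eq_iff)

lemma norm_complex_vec: "norm (complex_vec x) = norm x"
  by (simp add: complex_vec_def norm_vec_def)

text \<open>The eigenvalues of the inverse are the inverses of those of \<open>A\<close>, hence inside the unit disc.
  They may be complex, so the real vector is moved to the complex space.\<close>

lemma expansive_inverse_powers_summable:
  fixes A C :: "real ^ 'n ^ 'n"
  assumes "expansive A" and C: "A ** C = mat 1"
  shows "summable (\<lambda>n. norm (((*v) C ^^ n) x))"
proof -
  let ?T = "complex_matrix C"
  have pow: "((*v) ?T ^^ n) (complex_vec x) = complex_vec (((*v) C ^^ n) x)" for n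
    by (induction n) (auto simp: complex_matrix_vec)
  have eig: "cmod r < 1" if u: "?T *v u = r *s u" "u \<noteq> 0" for r u
  proof -
    have "u = complex_matrix A *v (?T *v u)"
      by (simp add: matrix_vector_mul_assoc complex_matrix_mult C complex_matrix_one)
    then have Au: "u = r *s (complex_matrix A *v u)" by (simp add: u vector_scalar_commute)
    then have "r \<noteq> 0" using u(2) by auto
    then have "complex_matrix A *v u = inverse r *s u"
      using arg_cong[OF Au, of "\<lambda>v. inverse r *s v"] by (simp add: vector_smult_assoc)
    then have "cmod (inverse r) > 1"
      using assms(1) u(2) unfolding expansive_def complex_matrix_def by blast
    then show ?thesis using \<open>r \<noteq> 0\<close> by (simp add: norm_inverse one_less_inverse_iff)
  qed
  obtain N and c :: "nat \<Rightarrow> real" where c: "\<exists>i\<le>N. c i \<noteq> 0" "(\<Sum>i\<le>N. c i *\<^sub>R ((*v) C ^^ i) x) = 0"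
    using sequence_linearly_dependent[of "\<lambda>i. ((*v) C ^^ i) x"] by blast
  define P where "P = (\<Sum>i\<le>N. monom (complex_of_real (c i)) i)"
  have coeff: "coeff P i = (if i \<le> N then complex_of_real (c i) else 0)" for i
    by (simp add: P_def coeff_sum)
  have "degree P \<le> N" by (rule degree_le) (simp add: coeff)
  then have "poly_act ?T P (complex_vec x) = (\<Sum>i\<le>N. complex_of_real (c i) *s complex_vec (((*v) C ^^ i) x))"
    by (simp add: poly_act_eq coeff pow)
  also have "\<dots> = complex_vec (\<Sum>i\<le>N. c i *\<^sub>R ((*v) C ^^ i) x)"
    by (simp add: complex_vec_def vec_eq_iff)
  finally have "poly_act ?T P (complex_vec x) = 0" by (simp add: c complex_vec_def vec_eq_iff)
  moreover have "P \<noteq> 0" using c(1) coeff by (metis coeff_0 of_real_eq_0_iff)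
  ultimately have "summable (\<lambda>n. norm (((*v) ?T ^^ n) (complex_vec x)))"
    by (intro summable_norm_iterates_of_annihilated[of ?T P] eig)
  then show ?thesis by (simp add: pow norm_complex_vec)
qed

lemma inner_funpow_matrix_transpose:
  fixes C :: "real ^ 'n ^ 'n"
  shows "((*v) (transpose C) ^^ n) x \<bullet> y = x \<bullet> ((*v) C ^^ n) y"
proof (induction n arbitrary: y)
  case (Suc n)
  have "((*v) (transpose C) ^^ Suc n) x \<bullet> y = ((*v) (transpose C) ^^ n) x \<bullet> (C *v y)"
    unfolding funpow.simps o_apply by (metis dot_lmul_matrix vector_transpose_matrix transpose_transpose)
  also have "\<dots> = x \<bullet> ((*v) C ^^ Suc n) y" unfolding Suc.IH by (simp add: funpow_swap1)
  finally show ?case .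
qed simp

text \<open>Expansiveness speaks of eigenvectors of \<open>A\<close>, while the maps \<open>\<tau>\<^sub>d\<close> use the transpose.  Pairing with
  basis vectors passes from one to the other, and also makes the bound uniform in \<open>x\<close>.\<close>

lemma expansive_transpose_inverse_powers_bound:
  fixes A :: "real ^ 'n ^ 'n"
  assumes "expansive A"
  obtains c where "summable c" "\<And>n. 0 \<le> c n"
    "\<And>n x. norm (((*v) (matrix_inv (transpose A)) ^^ n) x) \<le> c n * norm x"
proof -
  define C where "C = transpose (matrix_inv (transpose A))"
  have inv: "transpose A ** matrix_inv (transpose A) = mat 1 \<and> matrix_inv (transpose A) ** transpose A = mat 1"
    using expansive_invertible[OF assms] unfolding invertible_def matrix_inv_def by (rule someI_ex)
  then have AC: "A ** C = mat 1"
    unfolding C_def by (metis matrix_transpose_mul transpose_mat transpose_transpose)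
  define c where "c n = (\<Sum>b\<in>Basis. norm (((*v) C ^^ n) b))" for n
  have "norm (((*v) (matrix_inv (transpose A)) ^^ n) x) \<le> c n * norm x" for n x
  proof -
    have "norm (((*v) (transpose C) ^^ n) x) \<le> (\<Sum>b\<in>Basis. \<bar>((*v) (transpose C) ^^ n) x \<bullet> b\<bar>)"
      by (rule norm_le_l1)
    also have "\<dots> \<le> (\<Sum>b\<in>Basis. norm x * norm (((*v) C ^^ n) b))"
      by (intro sum_mono) (simp add: inner_funpow_matrix_transpose Cauchy_Schwarz_ineq2)
    finally show ?thesis by (simp add: C_def c_def sum_distrib_left mult.commute)
  qed
  moreover have "summable c"
    unfolding c_def by (intro summable_sum expansive_inverse_powers_summable[OF assms AC])
  moreover have "0 \<le> c n" for n by (simp add: c_def sum_nonneg)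
  ultimately show ?thesis using that by blast
qed

section \<open>Integer vectors, the torus and the solenoid\<close>

lemma funpow_eventually_periodic:
  fixes f :: "'a \<Rightarrow> 'a"
  assumes "(f ^^ a) x = (f ^^ (a + q)) x"
  shows "(f ^^ (a + i)) x = (f ^^ (a + i mod q)) x"
proof -
  have step: "(f ^^ (a + i + q)) x = (f ^^ (a + i)) x" for i
  proof -
    have "(f ^^ (a + i + q)) x = (f ^^ i) ((f ^^ (a + q)) x)"
      by (metis funpow_add o_apply add.commute add.left_commute)
    also have "\<dots> = (f ^^ (a + i)) x" by (metis assms funpow_add o_apply add.commute)
    finally show ?thesis .
  qed
  have "(f ^^ (a + (r + t * q))) x = (f ^^ (a + r)) x" for r t
  proof (induction t)
    case (Suc t)
    then show ?case using step[of "r + t * q"] by (simp add: ac_simps)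
  qed simp
  from this[of "i mod q" "i div q"] show ?thesis by simp
qed

lemma torus_pow_funpow_texp:
  assumes "int_matrix A"
  shows "(torus_pow A ^^ n) (texp x) = texp (((*v) (transpose A) ^^ n) x)"
  by (induction n) (auto simp: torus_pow_texp[OF assms])

lemma texp_add_int [simp]: "k \<in> int_vecs \<Longrightarrow> texp (x + k) = texp x" "k \<in> int_vecs \<Longrightarrow> texp (x - k) = texp x"
  by (auto simp: texp_eq_iff)

text \<open>As an equality of torus points, a congruence can be used for rewriting and passed through \<open>torus_pow\<close>.\<close>

lemma texp_coset: "x \<in> {t - k | k. k \<in> int_vecs} \<longleftrightarrow> texp x = texp t"
proof
  assume "texp x = texp t"
  then have "- (x - t) \<in> int_vecs" unfolding texp_eq_iff by (rule int_vecs_simps(2))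
  then show "x \<in> {t - k | k. k \<in> int_vecs}" by (auto intro!: exI[of _ "- (x - t)"])
qed auto

lemma continuous_on_texp: "continuous_on UNIV (texp :: real ^ 'n \<Rightarrow> _)"
  unfolding texp_def by (intro continuous_intros)

lemma tendsto_texp:
  assumes "(f \<longlongrightarrow> x) F"
  shows "((\<lambda>n. texp (f n)) \<longlongrightarrow> texp x) F"
  using continuous_on_tendsto_compose[OF continuous_on_texp assms] by simp

lemma int_vecs_norm_less_one: "x \<in> int_vecs \<Longrightarrow> norm x < 1 \<Longrightarrow> x = 0"
proof -
  assume x: "x \<in> int_vecs" "norm x < 1"
  have "x $ i = 0" for i
  proof -
    have "\<bar>x $ i\<bar> < 1" using x(2) component_le_norm_cart[of x i] by simp
    moreover obtain n where "x $ i = of_int n" using x(1) by (auto simp: int_vecs_def Ints_def)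
    ultimately show ?thesis by simp
  qed
  then show "x = 0" by (simp add: vec_eq_iff)
qed

lemma finite_int_vecs_norm_le: "finite {x :: real ^ 'n. x \<in> int_vecs \<and> norm x \<le> r}"
proof (rule finite_subset)
  let ?N = "\<lceil>r\<rceil>"
  show "{x :: real ^ 'n. x \<in> int_vecs \<and> norm x \<le> r}
      \<subseteq> vec_lambda ` PiE UNIV (\<lambda>_ :: 'n. real_of_int ` {- ?N..?N})"
  proof
    fix x :: "real ^ 'n" assume x: "x \<in> {x. x \<in> int_vecs \<and> norm x \<le> r}"
    have "x $ i \<in> real_of_int ` {- ?N..?N}" for i
    proof -
      have "\<bar>x $ i\<bar> \<le> r" using x component_le_norm_cart[of x i] by simp
      moreover obtain n where "x $ i = of_int n" using x by (auto simp: int_vecs_def Ints_def)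
      ultimately show ?thesis by (intro image_eqI[of _ _ n]) (auto simp: abs_le_iff; linarith)+
    qed
    then show "x \<in> vec_lambda ` PiE UNIV (\<lambda>_ :: 'n. real_of_int ` {- ?N..?N})"
      by (intro image_eqI[of _ _ "vec_nth x"]) auto
  qed
qed (auto intro!: finite_PiE)

lemma solenoid_funpow:
  "z \<in> solenoid A \<Longrightarrow> (torus_pow A ^^ N) (z (N + n)) = z n"
  by (induction N) (auto simp: solenoid_def funpow_swap1)

text \<open>Every coordinate of a solenoid element determines all earlier ones, so agreement at arbitrarily late
  coordinates suffices.\<close>

lemma solenoid_eqI:
  assumes "z \<in> solenoid A" "w \<in> solenoid A" "\<And>n. \<exists>N\<ge>n. z N = w N"
  shows "z = w"
proof
  fix n
  obtain N where "n \<le> N" "z N = w N" using assms(3) by blast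
  then show "z n = w n"
    using solenoid_funpow[OF assms(1), of "N - n" n] solenoid_funpow[OF assms(2), of "N - n" n] by simp
qed

lemma inv_sigma_map_shift:
  assumes "z \<in> solenoid A"
  shows "inv_into (solenoid A) (sigma_map A) z = (\<lambda>n. z (Suc n))"
proof (rule inv_into_f_eq)
  show "inj_on (sigma_map A) (solenoid A)"
  proof (rule inj_onI, rule ext)
    fix v w n assume "sigma_map A v = sigma_map A w"
    then have "sigma_map A v (Suc n) = sigma_map A w (Suc n)" by simp
    then show "v n = w n" by (simp add: sigma_map_def)
  qed
  show "(\<lambda>n. z (Suc n)) \<in> solenoid A" using assms by (simp add: solenoid_def)
  show "sigma_map A (\<lambda>n. z (Suc n)) = z"
    using assms by (auto simp: solenoid_def sigma_map_def fun_eq_iff split: nat.splits)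
qed

lemma tau_word_add:
  "tau_word A \<omega> (N + n) x = tau_word A (\<lambda>i. \<omega> (N + i)) n (tau_word A \<omega> N x)"
  by (induction n) auto

lemma tau_word_cong: "(\<And>i. i < n \<Longrightarrow> \<omega> i = \<omega>' i) \<Longrightarrow> tau_word A \<omega> n x = tau_word A \<omega>' n x"
  by (induction n) auto

lemma tau_word_period:
  assumes "\<And>i. \<omega> (i + q) = \<omega> i" "tau_word A \<omega> q x = x"
  shows "tau_word A \<omega> (q * t) x = x"
proof (induction t)
  case (Suc t)
  have "(\<lambda>i. \<omega> (q + i)) = \<omega>" using assms(1) by (simp add: add.commute)
  then show ?case using tau_word_add[of A \<omega> q "q * t" x] Suc assms(2) by simp
qed simp

section \<open>Digit expansions and the attractor\<close>

locale expansive_digits =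
  fixes A :: "real ^ 'n ^ 'n" and D :: "(real ^ 'n) set"
  assumes int_A: "int_matrix A" and exp_A: "expansive A" and res_D: "complete_residues A D"
begin

abbreviation B :: "real ^ 'n \<Rightarrow> real ^ 'n" where "B \<equiv> (*v) (transpose A)"
abbreviation M :: "real ^ 'n \<Rightarrow> real ^ 'n" where "M \<equiv> (*v) (matrix_inv (transpose A))"

lemma BM [simp]: "B (M x) = x" and MB [simp]: "M (B x) = x"
  by (simp_all add: matrix_inv_cancel expansive_invertible[OF exp_A])

lemma Bn_Mn [simp]: "(B ^^ n) ((M ^^ n) x) = x"
  by (induction n arbitrary: x) (auto simp: funpow_swap1)

lemma Mn_Bn [simp]: "(M ^^ n) ((B ^^ n) x) = x"
  by (induction n arbitrary: x) (auto simp: funpow_swap1)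

lemma Bn_int: "k \<in> int_vecs \<Longrightarrow> (B ^^ n) k \<in> int_vecs"
  by (induction n) (auto intro: int_matrix_mult[OF int_A])

lemma Mn_zero [simp]: "(M ^^ n) 0 = 0"
  by (induction n) auto

lemma D_int: "d \<in> D \<Longrightarrow> d \<in> int_vecs"
  using res_D by (auto simp: complete_residues_def)

lemma Mn_tendsto_zero: "(\<lambda>n. (M ^^ n) x) \<longlonglongrightarrow> 0"
proof -
  obtain c where c: "summable c" "\<And>n x. norm ((M ^^ n) x) \<le> c n * norm x"
    using expansive_transpose_inverse_powers_bound[OF exp_A] by metis
  have "(\<lambda>n. c n * norm x) \<longlonglongrightarrow> 0"
    using tendsto_mult_left_zero[OF summable_LIMSEQ_zero[OF c(1)]] .
  then show ?thesis by (rule Lim_null_comparison[rotated]) (simp add: c(2))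
qed

text \<open>Subtracting \<open>B k\<close>, where \<open>k\<close> is the integer part of \<open>M d\<close>, moves each digit \<open>d\<close> within its coset of
  \<open>B\<close>-multiples into the image of the unit cube.  That image is bounded and contains only finitely
  many integer vectors, and distinct digits lie in distinct cosets.\<close>

lemma finite_D: "finite D"
proof -
  obtain K where K: "\<And>x. norm (B x) \<le> K * norm x"
    using bounded_linear.bounded[OF matrix_vector_mul_bounded_linear[of "transpose A"]]
    by (metis mult.commute)
  define r where "r = \<bar>K\<bar> * real CARD('n)"
  have "\<exists>f. f \<in> int_vecs \<and> norm f \<le> r \<and> d - f \<in> B ` int_vecs" if "d \<in> D" for d
  proof -
    obtain k where k: "k \<in> int_vecs" "\<And>i. 0 \<le> (M d - k) $ i \<and> (M d - k) $ i < 1"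
      using cube_translate_ex1[of "M d"] by blast
    have "norm (M d - k) \<le> (\<Sum>i\<in>UNIV. \<bar>(M d - k) $ i\<bar>)" by (rule norm_le_l1_cart)
    also have "\<dots> \<le> (\<Sum>i\<in>(UNIV :: 'n set). 1)"
      by (rule sum_mono) (metis abs_of_nonneg k(2) less_imp_le)
    finally have n: "norm (M d - k) \<le> real CARD('n)" by simp
    have "norm (B (M d - k)) \<le> \<bar>K\<bar> * norm (M d - k)"
      using K by (rule order_trans) (intro mult_right_mono, auto)
    also have "\<dots> \<le> r" unfolding r_def using n by (intro mult_left_mono) auto
    also have "B (M d - k) = d - B k" by (simp add: matrix_vector_mult_diff_distrib)
    finally show ?thesis
      using k(1) that D_int int_matrix_mult[OF int_A k(1)] by (intro exI[of _ "d - B k"]) auto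
  qed
  then obtain f where f: "\<And>d. d \<in> D \<Longrightarrow> f d \<in> int_vecs \<and> norm (f d) \<le> r \<and> d - f d \<in> B ` int_vecs"
    by metis
  have "inj_on f D"
  proof (rule inj_onI)
    fix d e assume de: "d \<in> D" "e \<in> D" "f d = f e"
    obtain a where a: "a \<in> int_vecs" "d - f d = B a" using f[OF de(1)] by auto
    obtain b where b: "b \<in> int_vecs" "e - f e = B b" using f[OF de(2)] by auto
    from a b have "d - e = B (a - b)" using de by (simp add: matrix_vector_mult_diff_distrib algebra_simps)
    then have "d - e \<in> B ` int_vecs" using a b by auto
    moreover have "B 0 \<in> B ` int_vecs" by (rule imageI) simp
    then have "d - d \<in> B ` int_vecs" by simp
    moreover have "\<exists>!c. c \<in> D \<and> d - c \<in> B ` int_vecs"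
      using res_D D_int[OF de(1)] by (simp add: complete_residues_def)
    ultimately show "d = e" using de(1,2) by metis
  qed
  moreover have "finite (f ` D)"
    using f by (intro finite_subset[OF _ finite_int_vecs_norm_le[of r]]) auto
  ultimately show ?thesis by (rule finite_imageD[rotated])
qed

definition digit_sum :: "(nat \<Rightarrow> real ^ 'n) \<Rightarrow> nat \<Rightarrow> real ^ 'n" where
  "digit_sum \<omega> n = (\<Sum>i<n. (B ^^ i) (\<omega> i))"

lemma digit_sum_int: "\<omega> \<in> words D \<Longrightarrow> digit_sum \<omega> n \<in> int_vecs"
  unfolding digit_sum_def by (induction n) (auto simp: words_def intro!: int_vecs_simps(3) Bn_int[OF D_int])

text \<open>The central formula: acting by a word is adding an integer vector and then contracting.  Hence two
  points stay \<open>M\<^sup>n\<close> of their difference apart, whatever the word is.\<close>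

lemma tau_word_eq: "tau_word A \<omega> n x = (M ^^ n) (x + digit_sum \<omega> n)"
proof (induction n)
  case (Suc n)
  have "tau_word A \<omega> n x + \<omega> n = (M ^^ n) (x + digit_sum \<omega> (Suc n))"
    by (simp add: Suc digit_sum_def funpow_matrix_add)
  then show ?case by (simp add: tau_def)
qed (simp add: digit_sum_def)

text \<open>The same point with the latest digit first.  In this form the digit contributions are dominated by
  one convergent series, for all words and all lengths simultaneously.\<close>

lemma tau_word_expand:
  "tau_word A \<omega> n x = (M ^^ n) x + (\<Sum>i<n. (M ^^ Suc i) (\<omega> (n - Suc i)))"
proof (induction n)
  case (Suc n)
  have "tau_word A \<omega> (Suc n) x = M (tau_word A \<omega> n x) + M (\<omega> n)"
    by (simp add: tau_def matrix_vector_right_distrib)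
  also have "M (tau_word A \<omega> n x) = (M ^^ Suc n) x + (\<Sum>i<n. (M ^^ Suc (Suc i)) (\<omega> (n - Suc i)))"
    unfolding Suc by (simp add: matrix_vector_right_distrib vec.linear_sum[OF matrix_vector_mul_linear_gen])
  finally show ?case by (subst sum.lessThan_Suc_shift) simp
qed simp

lemma tau_word_bounded:
  obtains R where "\<And>\<omega> n. \<omega> \<in> words D \<Longrightarrow> norm (tau_word A \<omega> n x) \<le> R"
proof -
  obtain c where c: "summable c" "\<And>n. 0 \<le> c n" "\<And>n x. norm ((M ^^ n) x) \<le> c n * norm x"
    using expansive_transpose_inverse_powers_bound[OF exp_A] by metis
  obtain K where K: "\<And>d. d \<in> D \<Longrightarrow> norm d \<le> K"
    using finite_imp_bounded[OF finite_D] by (auto simp: bounded_iff)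
  define H where "H = norm x + \<bar>K\<bar>"
  have H: "norm x \<le> H" "\<And>d. d \<in> D \<Longrightarrow> norm d \<le> H" "0 \<le> H"
    using K norm_ge_zero[of x] by (auto simp: H_def) (smt (verit, best) norm_ge_zero)
  have "norm (tau_word A \<omega> n x) \<le> suminf c * H + suminf c * H" if "\<omega> \<in> words D" for \<omega> n
  proof -
    have "norm (tau_word A \<omega> n x) \<le> norm ((M ^^ n) x) + (\<Sum>i<n. norm ((M ^^ Suc i) (\<omega> (n - Suc i))))"
      unfolding tau_word_expand by (rule order_trans[OF norm_triangle_ineq add_left_mono[OF norm_sum]])
    also have "\<dots> \<le> c n * H + (\<Sum>i<n. c (Suc i) * H)"
      using that by (intro add_mono sum_mono order_trans[OF c(3)] mult_left_mono c(2) H) (auto simp: words_def)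
    also have "(\<Sum>i<n. c (Suc i) * H) = (\<Sum>i\<in>Suc ` {..<n}. c i) * H"
      by (simp add: sum_distrib_right sum.reindex)
    also have "c n * H + \<dots> \<le> suminf c * H + suminf c * H"
      using sum_le_suminf[OF c(1), of "{n}"] c(2)
      by (intro add_mono mult_right_mono H sum_le_suminf[OF c(1)]) auto
    finally show ?thesis .
  qed
  then show ?thesis using that by blast
qed

lemma encode_in_solenoid:
  assumes "\<omega> \<in> words D"
  shows "encode A (x, \<omega>) \<in> solenoid A"
  using assms D_int by (auto simp: solenoid_def encode_def torus_pow_texp[OF int_A] tau_def words_def)

text \<open>Running backwards through the cycle expresses a cycle point as a partial digit expansion plus
  \<open>M\<^sup>n\<close> of another cycle point.  The latter stay in a finite set, so the remainder tends to \<open>0\<close>.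
  Below, \<open>r n\<close> is the index \<open>i - n\<close> modulo \<open>q\<close>, with \<open>-1\<close> written as \<open>q - 1\<close>.\<close>

lemma cycle_in_attractor:
  assumes c: "is_cycle A D q m \<eta>" and i: "i < q"
  shows "\<eta> i \<in> attractor A D"
proof -
  have q: "0 < q" using i by simp
  define r where "r n = (i + (q - 1) * n) mod q" for n
  define d where "d n = m (r (Suc n))" for n
  have r: "r n < q" "Suc (r (Suc n)) mod q = r n" for n
  proof -
    show "r n < q" using q by (simp add: r_def)
    have "Suc (i + (q - 1) * Suc n) = i + (q - 1) * n + q" using q by simp
    then show "Suc (r (Suc n)) mod q = r n" by (simp only: r_def mod_Suc_eq mod_add_self2)
  qed
  have step: "\<eta> (r n) = M (\<eta> (r (Suc n)) + d n)" for n
    using c r[of n] r(1)[of "Suc n"] by (metis is_cycle_def tau_def d_def)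
  have sum: "\<eta> i - (M ^^ n) (\<eta> (r n)) = (\<Sum>j<n. (M ^^ Suc j) (d j))" for n
  proof (induction n)
    case (Suc n)
    have "(M ^^ n) (\<eta> (r n)) = (M ^^ Suc n) (\<eta> (r (Suc n))) + (M ^^ Suc n) (d n)"
      by (subst step) (simp add: funpow_matrix_add matrix_vector_right_distrib funpow_swap1)
    with Suc show ?case by (simp add: algebra_simps)
  qed (use i in \<open>simp add: r_def\<close>)
  obtain b where b: "summable b" "\<And>n. 0 \<le> b n" "\<And>n x. norm ((M ^^ n) x) \<le> b n * norm x"
    using expansive_transpose_inverse_powers_bound[OF exp_A] by metis
  define K where "K = (\<Sum>j<q. norm (\<eta> j))"
  have K: "norm (\<eta> (r n)) \<le> K" for n
    unfolding K_def using r(1)[of n] by (intro member_le_sum) auto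
  have "(\<lambda>n. b n * K) \<longlonglongrightarrow> 0"
    using tendsto_mult_left_zero[OF summable_LIMSEQ_zero[OF b(1)]] .
  then have "(\<lambda>n. (M ^^ n) (\<eta> (r n))) \<longlonglongrightarrow> 0"
    by (rule Lim_null_comparison[rotated])
       (use order_trans[OF b(3) mult_left_mono[OF K b(2)]] in simp)
  then have "(\<lambda>n. \<eta> i - (M ^^ n) (\<eta> (r n))) \<longlonglongrightarrow> \<eta> i - 0"
    by (intro tendsto_diff tendsto_const)
  then have "(\<lambda>j. (M ^^ Suc j) (d j)) sums \<eta> i" unfolding sums_def sum by simp
  moreover have "d j \<in> D" for j using c r(1) by (auto simp: d_def is_cycle_def)
  ultimately show ?thesis unfolding attractor_def by blast
qed

text \<open>The attractor is the image of the compact product space of all digit sequences under a uniformly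
  convergent series.  Compactness is what makes the exceptional set of the tiling a Borel set.\<close>

lemma compact_attractor: "compact (attractor A D)"
proof -
  let ?W = "PiE UNIV (\<lambda>_ :: nat. D)"
  obtain c where c: "summable c" "\<And>n. 0 \<le> c n" "\<And>n x. norm ((M ^^ n) x) \<le> c n * norm x"
    using expansive_transpose_inverse_powers_bound[OF exp_A] by metis
  obtain K where K: "\<And>d. d \<in> D \<Longrightarrow> norm d \<le> K"
    using finite_imp_bounded[OF finite_D] by (auto simp: bounded_iff)
  have bound: "norm ((M ^^ Suc j) (\<omega> j)) \<le> c (Suc j) * K" if "\<omega> \<in> ?W" for \<omega> j
    using that K c(2) by (intro order_trans[OF c(3)] mult_left_mono) auto
  have summ: "summable (\<lambda>j. c (Suc j) * K)" using c(1) by (intro summable_mult2) (simp add: summable_Suc_iff)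
  have cont: "continuous_on ?W (\<lambda>\<omega>. \<Sum>j. (M ^^ Suc j) (\<omega> j))"
  proof (rule uniform_limit_theorem)
    show "uniform_limit ?W (\<lambda>n \<omega>. \<Sum>j<n. (M ^^ Suc j) (\<omega> j)) (\<lambda>\<omega>. \<Sum>j. (M ^^ Suc j) (\<omega> j)) sequentially"
      by (rule Weierstrass_m_test[OF bound summ]) auto
    have pow: "continuous_on UNIV (M ^^ n)" for n
    proof (induction n)
      case (Suc n)
      then show ?case
        by (auto simp: o_def intro: continuous_on_compose2[OF matrix_vector_mult_linear_continuous_on[of UNIV]])
    qed (simp add: id_def continuous_on_id)
    show "\<forall>\<^sub>F n in sequentially. continuous_on ?W (\<lambda>\<omega>. \<Sum>j<n. (M ^^ Suc j) (\<omega> j))"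
      by (intro always_eventually allI continuous_on_sum continuous_on_compose2[OF pow]
          continuous_on_subset[OF continuous_on_product_coordinates]) auto
  qed auto
  have "compactin (product_topology (\<lambda>_ :: nat. euclidean) UNIV) ?W"
    unfolding compactin_PiE using finite_imp_compact[OF finite_D] by simp
  then have "compact ?W" unfolding euclidean_product_topology by simp
  with cont have "compact ((\<lambda>\<omega>. \<Sum>j. (M ^^ Suc j) (\<omega> j)) ` ?W)" by (rule compact_continuous_image)
  also have "(\<lambda>\<omega>. \<Sum>j. (M ^^ Suc j) (\<omega> j)) ` ?W = attractor A D"
  proof -
    have "(\<lambda>j. (M ^^ Suc j) (\<omega> j)) sums (\<Sum>j. (M ^^ Suc j) (\<omega> j))" if "\<omega> \<in> ?W" for \<omega>
      using summable_comparison_test'[OF summ bound[OF that]] by (simp add: summable_sums)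
    then show ?thesis
      unfolding attractor_def by (auto simp: sums_iff image_iff PiE_def)
  qed
  finally show ?thesis .
qed

lemma attractor_digit:
  assumes "x \<in> attractor A D"
  obtains d where "d \<in> D" "B x - d \<in> attractor A D"
proof -
  obtain d where d: "\<And>j. d j \<in> D" "(\<lambda>j. (M ^^ Suc j) (d j)) sums x"
    using assms unfolding attractor_def by blast
  have "(\<lambda>j. B ((M ^^ Suc j) (d j))) sums B x"
    using bounded_linear.sums[OF matrix_vector_mul_bounded_linear d(2)] .
  then have "(\<lambda>j. (M ^^ j) (d j)) sums B x" by simp
  then have "(\<lambda>j. (M ^^ Suc j) (d (Suc j))) sums (B x - d 0)" by (subst sums_Suc_iff) simp
  then have "B x - d 0 \<in> attractor A D"
    unfolding attractor_def using d(1) by (auto intro!: exI[of _ "\<lambda>j. d (Suc j)"])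
  then show ?thesis using d(1) that by blast
qed

lemma mem_tau_image_attractor: "x \<in> tau A d ` attractor A D \<longleftrightarrow> B x - d \<in> attractor A D"
proof
  assume "B x - d \<in> attractor A D"
  then show "x \<in> tau A d ` attractor A D" by (intro image_eqI[of _ _ "B x - d"]) (auto simp: tau_def)
qed (auto simp: tau_def)

end

section \<open>The cycle solenoid as a union of copies of Euclidean space\<close>

locale digit_cycle = expansive_digits A D
  for A :: "real ^ 'n ^ 'n" and D :: "(real ^ 'n) set" +
  fixes p :: nat and l \<theta> :: "nat \<Rightarrow> real ^ 'n"
  assumes simple: "simple_cycle A D p l \<theta>"
begin

abbreviation th :: "nat \<Rightarrow> real ^ 'n" where "th i \<equiv> \<theta> (i mod p)"

abbreviation \<Omega>\<^sub>C :: "(nat \<Rightarrow> real ^ 'n) set" where "\<Omega>\<^sub>C \<equiv> Omega_tilde A D p \<theta>"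

lemma cycle: "is_cycle A D p l \<theta>"
  using simple by (simp add: simple_cycle_def)

lemma p_pos [simp]: "0 < p"
  using cycle by (simp add: is_cycle_def)

lemma l_in_D: "l (i mod p) \<in> D"
  using cycle by (simp add: is_cycle_def)

lemma B_th: "B (th (Suc i)) = th i + l (i mod p)"
proof -
  have "tau A (l (i mod p)) (th i) = th (Suc i)"
    using cycle by (simp add: is_cycle_def mod_Suc_eq)
  then show ?thesis by (metis BM tau_def)
qed

lemma torus_pow_th: "torus_pow A (texp (th (Suc i))) = texp (th i)"
  using D_int[OF l_in_D] by (simp add: torus_pow_texp[OF int_A] B_th)

lemma texp_theta_inj: "texp (th i) = texp (th j) \<longleftrightarrow> i mod p = j mod p"
proof
  assume "texp (th i) = texp (th j)"
  then have "th i - th j \<in> int_vecs" by (simp add: texp_eq_iff)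
  then show "i mod p = j mod p"
    using simple mod_less_divisor[OF p_pos] unfolding simple_cycle_def by blast
qed simp

lemma ihat_cycle_in_solenoid: "ihat_cycle A p \<theta> (x, j) \<in> solenoid A"
proof -
  have "texp (y + B (th (Suc i))) = texp (y + th i)" for y i
    using torus_pow_th by (simp add: torus_pow_texp[OF int_A] texp_add)
  then show ?thesis
    by (simp add: solenoid_def ihat_cycle_def torus_pow_texp[OF int_A] matrix_vector_right_distrib)
qed

text \<open>Along multiples of \<open>p\<close> the Euclidean part contracts to \<open>0\<close>, so equal images have congruent cycle
  points in the limit, and simplicity of the cycle gives equal indices.  Then \<open>M\<^sup>n (x - y)\<close> is an
  integer vector for every \<open>n\<close> and tends to \<open>0\<close>, so it vanishes for some \<open>n\<close>.\<close>

lemma ihat_cycle_inj: "inj_on (ihat_cycle A p \<theta>) (UNIV \<times> {..<p})"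
proof (rule inj_onI, clarify)
  fix x y i j assume ij: "i < p" "j < p" and eq: "ihat_cycle A p \<theta> (x, i) = ihat_cycle A p \<theta> (y, j)"
  have e: "texp ((M ^^ n) x + th (n + i)) = texp ((M ^^ n) y + th (n + j))" for n
    using fun_cong[OF eq, of n] by (simp add: ihat_cycle_def)
  have lim: "(\<lambda>n. texp ((M ^^ (p * n)) x + \<theta> i)) \<longlonglongrightarrow> texp (0 + \<theta> i)" for x i
  proof (intro tendsto_texp tendsto_add tendsto_const)
    show "(\<lambda>n. (M ^^ (p * n)) x) \<longlonglongrightarrow> 0"
      using LIMSEQ_subseq_LIMSEQ[OF Mn_tendsto_zero[of x], of "\<lambda>n. p * n"]
      by (simp add: strict_mono_def o_def)
  qed
  have "texp ((M ^^ (p * n)) x + \<theta> i) = texp ((M ^^ (p * n)) y + \<theta> j)" for n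
    using e[of "p * n"] ij by simp
  then have "texp (0 + \<theta> i) = texp (0 + \<theta> j)"
    using LIMSEQ_unique[OF lim[of x i]] lim[of y j] by simp
  then have "i = j" using texp_theta_inj[of i j] ij by simp
  have int: "(M ^^ n) (x - y) \<in> int_vecs" for n
    using e[of n] unfolding \<open>i = j\<close> by (simp add: texp_eq_iff funpow_matrix_diff)
  obtain n where "norm ((M ^^ n) (x - y)) < 1"
    using LIMSEQ_D[OF Mn_tendsto_zero[of "x - y"], of 1] by auto
  then have "(M ^^ n) (x - y) = 0" using int int_vecs_norm_less_one by blast
  then have "x - y = 0" by (metis Bn_Mn Mn_Bn Mn_zero)
  then show "x = y \<and> i = j" using \<open>i = j\<close> by simp
qed

lemma inv_sigma_funpow_chi:
  "(inv_into (solenoid A) (sigma_map A) ^^ j) (chi p \<theta>) = (\<lambda>n. texp (th (n + j)))"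
proof (induction j)
  case (Suc j)
  have "(\<lambda>n. texp (th (n + j))) \<in> solenoid A" using torus_pow_th by (simp add: solenoid_def)
  then show ?case by (simp add: Suc inv_sigma_map_shift)
qed (simp add: chi_def)

lemma ihat_cycle_image: "ihat_cycle A p \<theta> ` (UNIV \<times> {..<p}) = cycle_solenoid A p \<theta>"
  by (auto simp: cycle_solenoid_def inv_sigma_funpow_chi ihat_def ihat_cycle_def texp_add mult.commute image_iff)

lemma bij_betw_ihat_cycle: "bij_betw (ihat_cycle A p \<theta>) (UNIV \<times> {..<p}) (cycle_solenoid A p \<theta>)"
  using ihat_cycle_inj ihat_cycle_image by (rule bij_betw_imageI)

lemma ihat_cycle_alpha:
  assumes "j < p"
  shows "ihat_cycle A p \<theta> (alpha A p (x, j)) = sigma_map A (ihat_cycle A p \<theta> (x, j))"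
proof
  fix n
  \<comment> \<open>Subtraction on naturals: \<open>j - 1\<close> modulo \<open>p\<close> is represented by \<open>j + p - 1\<close>.\<close>
  have shift: "(n + (j + p - 1) mod p) mod p = (n + j + p - 1) mod p" for n
  proof -
    have "n + (j + p - 1) = n + j + p - 1" using p_pos by linarith
    then show ?thesis by (simp only: mod_add_right_eq)
  qed
  show "ihat_cycle A p \<theta> (alpha A p (x, j)) n = sigma_map A (ihat_cycle A p \<theta> (x, j)) n"
  proof (cases n)
    case 0
    have "torus_pow A (texp (th (Suc (j + p - 1)))) = texp (th (j + p - 1))" by (rule torus_pow_th)
    then have "texp (B x + B (th j)) = texp (B x + th (j + p - 1))"
      by (simp add: torus_pow_texp[OF int_A] texp_add)
    then show ?thesis
      by (simp add: 0 sigma_map_def ihat_cycle_def alpha_def torus_pow_texp[OF int_A]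
          matrix_vector_right_distrib)
  next
    case (Suc m)
    have "(n + (j + p - 1) mod p) mod p = (m + j) mod p"
      unfolding shift unfolding Suc by simp
    then show ?thesis
      by (simp add: Suc sigma_map_def ihat_cycle_def alpha_def funpow_swap1)
  qed
qed

section \<open>Words and backward orbits\<close>

text \<open>Since \<open>a - \<theta>\<^sub>i = B (b - \<theta>\<^sub>i\<^sub>+\<^sub>1) + d\<close> is equivalent to \<open>a + l\<^sub>i = B b + d\<close>, uniqueness of the digit is the
  complete residue property, and the index \<open>i\<close> is recovered from the point by simplicity.\<close>

lemma R_cycle_eqI:
  assumes "a \<in> int_vecs" "b \<in> int_vecs" "d \<in> D" "a - th i = B (b - th (Suc i)) + d"
  shows "R_cycle A D p \<theta> (a - th i) = b - th (Suc i)"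
  unfolding R_cycle_def
proof (rule the_equality)
  show "\<exists>a'\<in>int_vecs. \<exists>j<p. \<exists>b'\<in>int_vecs. \<exists>d'\<in>D. a - th i = a' - \<theta> j \<and>
      b - th (Suc i) = b' - \<theta> (Suc j mod p) \<and> a - th i = B (b - th (Suc i)) + d'"
    using assms by (intro bexI[of _ a] exI[of _ "i mod p"] conjI bexI[of _ b] bexI[of _ d]) (auto simp: mod_Suc_eq)
next
  fix w assume "\<exists>a'\<in>int_vecs. \<exists>j<p. \<exists>b'\<in>int_vecs. \<exists>d'\<in>D. a - th i = a' - \<theta> j \<and>
      w = b' - \<theta> (Suc j mod p) \<and> a - th i = B w + d'"
  then obtain a' j b' d' where w: "a' \<in> int_vecs" "j < p" "b' \<in> int_vecs" "d' \<in> D"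
    "a - th i = a' - \<theta> j" "w = b' - \<theta> (Suc j mod p)" "a - th i = B w + d'" by blast
  have "th i - th j = a - a'" using w(2,5) by (simp add: algebra_simps)
  then have "texp (th i) = texp (th j)" using assms(1) w(1) by (simp add: texp_eq_iff)
  then have j: "j = i mod p" using texp_theta_inj w(2) by (metis mod_less)
  have eq: "a + l (i mod p) - d = B b" "a + l (i mod p) - d' = B b'"
  proof -
    show "a + l (i mod p) - d = B b"
      using assms(4) by (simp add: matrix_vector_mult_diff_distrib B_th algebra_simps)
    have "a - th i = B (b' - th (Suc i)) + d'" using w j by (simp add: mod_Suc_eq)
    then show "a + l (i mod p) - d' = B b'"
      by (simp add: matrix_vector_mult_diff_distrib B_th algebra_simps)
  qed
  have "\<exists>!c. c \<in> D \<and> (a + l (i mod p)) - c \<in> B ` int_vecs"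
    using res_D assms(1) D_int[OF l_in_D] by (simp add: complete_residues_def)
  then have "d = d'" using eq assms w by (metis imageI)
  then have "B (b - th (Suc i)) = B w" using assms(4) w(7) by simp
  then show "w = b - th (Suc i)" by (metis MB)
qed

lemma R_cycle_step:
  assumes "a \<in> int_vecs"
  obtains b d where "b \<in> int_vecs" "d \<in> D" "a - th i = B (b - th (Suc i)) + d"
    "R_cycle A D p \<theta> (a - th i) = b - th (Suc i)"
proof -
  have "\<exists>!c. c \<in> D \<and> (a + l (i mod p)) - c \<in> B ` int_vecs"
    using res_D assms D_int[OF l_in_D] by (simp add: complete_residues_def)
  then obtain d b where db: "d \<in> D" "b \<in> int_vecs" "a + l (i mod p) - d = B b" by blast
  then have "a - th i = B (b - th (Suc i)) + d"
    by (simp add: matrix_vector_mult_diff_distrib B_th algebra_simps)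
  with R_cycle_eqI[OF assms db(2,1)] show ?thesis using db that by blast
qed

lemma R_cycle_orbit:
  assumes "k \<in> int_vecs" "j < p"
  shows "\<exists>a\<in>int_vecs. (R_cycle A D p \<theta> ^^ n) (k - \<theta> j) = a - th (n + j)"
proof (induction n)
  case 0
  then show ?case using assms by (auto intro: bexI[of _ k])
next
  case (Suc n)
  then obtain a where a: "a \<in> int_vecs" "(R_cycle A D p \<theta> ^^ n) (k - \<theta> j) = a - th (n + j)" by blast
  obtain b where "b \<in> int_vecs" "R_cycle A D p \<theta> (a - th (n + j)) = b - th (Suc (n + j))"
    using R_cycle_step[OF a(1)] by metis
  then show ?case using a by auto
qed

lemma omega_of_in_words:
  assumes "k \<in> int_vecs" "j < p"
  shows "omega_of A D p \<theta> k j \<in> words D"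
proof -
  have "omega_of A D p \<theta> k j n \<in> D" for n
  proof -
    obtain a where a: "a \<in> int_vecs" "(R_cycle A D p \<theta> ^^ n) (k - \<theta> j) = a - th (n + j)"
      using R_cycle_orbit[OF assms] by blast
    obtain b d where "d \<in> D" "a - th (n + j) = B (b - th (Suc (n + j))) + d"
      "R_cycle A D p \<theta> (a - th (n + j)) = b - th (Suc (n + j))"
      using R_cycle_step[OF a(1)] by metis
    then show ?thesis by (simp add: omega_of_def a(2))
  qed
  then show ?thesis by (simp add: words_def)
qed

lemma backward_orbit_eqI:
  assumes "v 0 = k - \<theta> j" "\<And>n. v n = B (v (Suc n)) + \<omega> n"
  shows "v n = (M ^^ n) (k - \<theta> j - digit_sum \<omega> n)"
proof (induction n)
  case (Suc n)
  have "v (Suc n) = M (v n - \<omega> n)" using assms(2)[of n] by simp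
  also have "v n - \<omega> n = (M ^^ n) (k - \<theta> j - digit_sum \<omega> (Suc n))"
    by (simp add: Suc digit_sum_def funpow_matrix_diff funpow_matrix_add)
  finally show ?case by simp
qed (simp add: assms(1) digit_sum_def)

lemma R_cycle_orbit_eq:
  "(R_cycle A D p \<theta> ^^ n) (k - \<theta> j) = (M ^^ n) (k - \<theta> j - digit_sum (omega_of A D p \<theta> k j) n)"
  by (rule backward_orbit_eqI) (auto simp: omega_of_def)

text \<open>The bridge between the two parametrisations.  Put \<open>v\<^sub>n = M\<^sup>n (k - \<theta>\<^sub>j - \<Sum>\<^sub>i B\<^sup>i \<omega>\<^sub>i)\<close>, with \<open>i < n\<close>.  The
  \<open>n\<close>-th coordinates agree exactly if \<open>v\<^sub>n + \<theta>\<^sub>n\<^sub>+\<^sub>j\<close> is an integer vector; the point \<open>y\<close> cancels.  As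
  \<open>v\<^sub>n = B v\<^sub>n\<^sub>+\<^sub>1 + \<omega>\<^sub>n\<close>, this holds for all \<open>n\<close> exactly if \<open>v\<close> is the orbit of \<open>k - \<theta>\<^sub>j\<close> under the
  cycle map, and then its digits are the \<open>\<omega>\<^sub>n\<close>.\<close>

lemma encode_eq_ihat_cycle_iff:
  assumes \<omega>: "\<omega> \<in> words D" and k: "k \<in> int_vecs" and j: "j < p"
  shows "encode A (y, \<omega>) = ihat_cycle A p \<theta> (y - \<theta> j + k, j) \<longleftrightarrow> \<omega> = omega_of A D p \<theta> k j"
proof -
  define v where "v n = (M ^^ n) (k - \<theta> j - digit_sum \<omega> n)" for n
  have diff: "tau_word A \<omega> n y - ((M ^^ n) (y - \<theta> j + k) + th (n + j)) = - (v n + th (n + j))" for n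
    by (simp add: tau_word_eq v_def funpow_matrix_diff funpow_matrix_add)
  have neg: "- x \<in> int_vecs \<longleftrightarrow> x \<in> int_vecs" for x :: "real ^ 'n"
    using int_vecs_simps(2)[of x] int_vecs_simps(2)[of "- x"] by auto
  have iff: "encode A (y, \<omega>) = ihat_cycle A p \<theta> (y - \<theta> j + k, j) \<longleftrightarrow> (\<forall>n. v n + th (n + j) \<in> int_vecs)"
    unfolding fun_eq_iff encode_def ihat_cycle_def prod.case texp_eq_iff diff neg ..
  show ?thesis
  proof
    assume "\<omega> = omega_of A D p \<theta> k j"
    then have "v n = (R_cycle A D p \<theta> ^^ n) (k - \<theta> j)" for n
      by (simp add: v_def R_cycle_orbit_eq)
    then have "v n + th (n + j) \<in> int_vecs" for n
      using R_cycle_orbit[OF k j, of n] by auto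
    then show "encode A (y, \<omega>) = ihat_cycle A p \<theta> (y - \<theta> j + k, j)" using iff by blast
  next
    assume "encode A (y, \<omega>) = ihat_cycle A p \<theta> (y - \<theta> j + k, j)"
    with iff have int: "v n + th (n + j) \<in> int_vecs" for n by blast
    have step: "v n = B (v (Suc n)) + \<omega> n" for n
      by (simp add: v_def digit_sum_def funpow_matrix_diff funpow_matrix_add)
    have R: "R_cycle A D p \<theta> (v n) = v (Suc n)" for n
      using R_cycle_eqI[OF int[of n] int[of "Suc n"], of "\<omega> n" "n + j"] step[of n] \<omega>
      by (simp add: words_def)
    have "v n = (R_cycle A D p \<theta> ^^ n) (k - \<theta> j)" for n
      by (induction n) (auto simp: R[symmetric], simp add: v_def digit_sum_def)
    then show "\<omega> = omega_of A D p \<theta> k j"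
      using step unfolding omega_of_def fun_eq_iff by (metis add_diff_cancel_left')
  qed
qed

text \<open>The orbit is bounded because it is, up to sign, the action of a word on the point \<open>\<theta>\<^sub>j - k\<close>; and the
  translates of the cycle points by integer vectors meet a bounded set in a finite set.\<close>

lemma R_cycle_orbit_repeats:
  assumes k: "k \<in> int_vecs" and j: "j < p"
  obtains a b where "a < b" "(R_cycle A D p \<theta> ^^ a) (k - \<theta> j) = (R_cycle A D p \<theta> ^^ b) (k - \<theta> j)"
proof -
  define u where "u n = (R_cycle A D p \<theta> ^^ n) (k - \<theta> j)" for n
  obtain r where r: "\<And>\<omega> n. \<omega> \<in> words D \<Longrightarrow> norm (tau_word A \<omega> n (\<theta> j - k)) \<le> r"
    using tau_word_bounded by metis
  have "u n = - tau_word A (omega_of A D p \<theta> k j) n (\<theta> j - k)" for n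
    by (simp add: u_def R_cycle_orbit_eq tau_word_eq funpow_matrix_add funpow_matrix_diff)
  then have bound: "norm (u n) \<le> r" for n
    using r[OF omega_of_in_words[OF k j]] by simp
  define s where "s = r + (\<Sum>i<p. norm (\<theta> i))"
  let ?F = "\<Union>i<p. (\<lambda>a. a - \<theta> i) ` {a. a \<in> int_vecs \<and> norm a \<le> s}"
  have "u n \<in> ?F" for n
  proof -
    obtain a where a: "a \<in> int_vecs" "u n = a - th (n + j)"
      using R_cycle_orbit[OF k j] unfolding u_def by blast
    have "norm (th (n + j)) \<le> (\<Sum>i<p. norm (\<theta> i))" by (intro member_le_sum) auto
    then have "norm a \<le> s"
      using bound[of n] norm_triangle_ineq[of "u n" "th (n + j)"] by (simp add: a s_def)
    then show ?thesis using a by (intro UN_I[of "(n + j) mod p"]) auto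
  qed
  moreover have "finite ?F" by (intro finite_UN_I finite_imageI finite_int_vecs_norm_le) auto
  ultimately have "finite (range u)" by (meson finite_subset image_subsetI)
  then have "\<not> inj u" using finite_imageD infinite_UNIV_nat by blast
  then obtain a b where "a \<noteq> b" "u a = u b" by (auto simp: inj_def)
  then show ?thesis using that[of a b] that[of b a] unfolding u_def by (cases "a < b") auto
qed

text \<open>The negatives of the periodic part of the orbit form a cycle congruent to part of the given one,
  with the emitted digits as its word: the cycle map is \<open>v \<mapsto> M (v - d)\<close>, while
  \<open>\<tau>\<^sub>d (- v) = - M (v - d)\<close>.\<close>

lemma omega_of_in_Omega_tilde:
  assumes k: "k \<in> int_vecs" and j: "j < p"
  shows "omega_of A D p \<theta> k j \<in> \<Omega>\<^sub>C"
proof -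
  define u where "u n = (R_cycle A D p \<theta> ^^ n) (k - \<theta> j)" for n
  define \<omega> where "\<omega> = omega_of A D p \<theta> k j"
  have \<omega>: "\<omega> \<in> words D" unfolding \<omega>_def by (rule omega_of_in_words[OF k j])
  have step: "\<omega> n = u n - B (u (Suc n))" for n by (simp add: \<omega>_def omega_of_def u_def)
  obtain a b where ab: "a < b" "u a = u b" using R_cycle_orbit_repeats[OF k j] unfolding u_def by metis
  define q where "q = b - a"
  have q: "0 < q" "u a = u (a + q)" using ab by (auto simp: q_def)
  have per: "u (a + i) = u (a + i mod q)" for i
    using q(2) unfolding u_def by (rule funpow_eventually_periodic)
  define \<eta> where "\<eta> i = - u (a + i)" for i
  define m where "m i = \<omega> (a + i)" for i
  have "tau A (m i) (\<eta> i) = \<eta> (Suc i mod q)" for i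
  proof -
    have "\<eta> i + m i = B (- u (a + Suc i))" by (simp add: \<eta>_def m_def step vec.linear_neg[OF matrix_vector_mul_linear_gen])
    then show ?thesis using per[of "Suc i"] by (simp add: tau_def \<eta>_def)
  qed
  then have cyc: "is_cycle A D q m \<eta>"
    using q(1) \<omega> by (simp add: is_cycle_def words_def m_def)
  have "\<eta> i \<in> {\<theta> j - k | j k. j < p \<and> k \<in> int_vecs}" for i
  proof -
    obtain a' where a': "a' \<in> int_vecs" "u (a + i) = a' - th (a + i + j)"
      using R_cycle_orbit[OF k j] unfolding u_def by blast
    then have "\<eta> i = th (a + i + j) - a'" by (simp add: \<eta>_def)
    then show ?thesis using a'(1) mod_less_divisor[OF p_pos] by blast
  qed
  then have sub: "\<eta> ` {..<q} \<subseteq> {\<theta> j - k | j k. j < p \<and> k \<in> int_vecs} \<inter> attractor A D"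
    using cycle_in_attractor[OF cyc] by auto
  have "\<omega> (a + n) = m (n mod q)" for n
    unfolding m_def step using per[of n] per[of "Suc n"] per[of "Suc (n mod q)"] by (simp add: mod_Suc_eq)
  then have "\<omega> \<in> Omega_word D q m" using \<omega> unfolding Omega_word_def by blast
  then show ?thesis using cyc sub unfolding Omega_tilde_def \<omega>_def[symmetric] by blast
qed

section \<open>The pair attached to an eventually periodic word\<close>

lemma Omega_tilde_words: "\<omega> \<in> \<Omega>\<^sub>C \<Longrightarrow> \<omega> \<in> words D"
  by (auto simp: Omega_tilde_def Omega_word_def)

lemma Omega_tilde_shift:
  assumes "\<omega> \<in> \<Omega>\<^sub>C" "d \<in> D"
  shows "case_nat d \<omega> \<in> \<Omega>\<^sub>C"
proof -
  obtain q m \<eta> N where c: "is_cycle A D q m \<eta>"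
    "\<eta> ` {..<q} \<subseteq> {\<theta> j - k | j k. j < p \<and> k \<in> int_vecs} \<inter> attractor A D"
    "\<omega> \<in> words D" "\<forall>n. \<omega> (N + n) = m (n mod q)"
    using assms(1) unfolding Omega_tilde_def Omega_word_def by blast
  have "case_nat d \<omega> \<in> words D" using c(3) assms(2) by (auto simp: words_def split: nat.splits)
  moreover have "\<forall>n. case_nat d \<omega> (Suc N + n) = m (n mod q)" using c(4) by simp
  ultimately have "case_nat d \<omega> \<in> Omega_word D q m" unfolding Omega_word_def by blast
  then show ?thesis using c(1,2) unfolding Omega_tilde_def by blast
qed

text \<open>The prefix must have a length divisible by \<open>p\<close>.  Lengthening it from \<open>N\<close> to \<open>N p\<close> rotates the
  repeated word and the cycle by \<open>s = N p - N\<close>.\<close>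

lemma Omega_tilde_periodic_rep:
  assumes "\<omega> \<in> \<Omega>\<^sub>C"
  obtains n q m \<eta> j where "periodic_rep A p \<omega> n q m \<eta>" "j < p" "texp \<eta> = texp (\<theta> j)"
proof -
  obtain q m \<eta> N where c: "is_cycle A D q m \<eta>"
    "\<eta> ` {..<q} \<subseteq> {\<theta> j - k | j k. j < p \<and> k \<in> int_vecs} \<inter> attractor A D"
    "\<And>n. \<omega> (N + n) = m (n mod q)"
    using assms(1) unfolding Omega_tilde_def Omega_word_def by blast
  have q: "0 < q" using c(1) by (simp add: is_cycle_def)
  define s where "s = N * p - N"
  have s: "N * p = N + s" by (simp add: s_def) (metis One_nat_def Suc_leI le_add_diff_inverse mult_le_mono2 nat_mult_1_right p_pos)
  have tw: "tau_word A (\<lambda>i. m ((s + i) mod q)) i (\<eta> (s mod q)) = \<eta> ((s + i) mod q)" for i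
  proof (induction i)
    case (Suc i)
    then show ?case using c(1) q by (simp add: is_cycle_def mod_Suc_eq)
  qed simp
  have "periodic_rep A p \<omega> N q (\<lambda>i. m ((s + i) mod q)) (\<eta> (s mod q))"
    using q c(3)[of "s + _"] tw[of q] unfolding periodic_rep_def s by (simp add: add.assoc mod_add_right_eq)
  moreover have "\<eta> (s mod q) \<in> {\<theta> j - k | j k. j < p \<and> k \<in> int_vecs}"
    using c(2) mod_less_divisor[OF q, of s] by blast
  then obtain j where "j < p" "texp (\<eta> (s mod q)) = texp (\<theta> j)" by auto
  ultimately show ?thesis using that by blast
qed

lemma periodic_rep_tail:
  assumes "periodic_rep A p \<omega> n q m \<eta>"
  shows "0 < q" "tau_word A (\<lambda>i. \<omega> (n * p + i)) (q * t) \<eta> = \<eta>"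
proof -
  show "0 < q" using assms by (simp add: periodic_rep_def)
  have "tau_word A (\<lambda>i. \<omega> (n * p + i)) q \<eta> = tau_word A m q \<eta>"
    using assms by (intro tau_word_cong) (simp add: periodic_rep_def)
  moreover have "\<omega> (n * p + (i + q)) = \<omega> (n * p + i)" for i
    using assms unfolding periodic_rep_def by (metis mod_add_self2)
  ultimately show "tau_word A (\<lambda>i. \<omega> (n * p + i)) (q * t) \<eta> = \<eta>"
    using assms by (intro tau_word_period) (simp_all add: periodic_rep_def)
qed

text \<open>Under the tail word the fixed point \<open>\<eta>\<close> returns to itself at all multiples of \<open>q\<close>, so at multiples
  of \<open>q p\<close> its code agrees with that of the cycle started at \<open>\<theta>\<^sub>j\<close>; by the solenoid property the two
  codes are equal.  Any other starting point differs from \<open>\<eta>\<close> by a contracting Euclidean part.\<close>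

lemma encode_periodic_rep:
  assumes \<omega>: "\<omega> \<in> words D" and rep: "periodic_rep A p \<omega> n q m \<eta>"
    and j: "j < p" "texp \<eta> = texp (\<theta> j)"
  defines "k \<equiv> digit_sum \<omega> (n * p) + \<theta> j - (B ^^ (n * p)) \<eta>"
  shows "encode A (x, \<omega>) = ihat_cycle A p \<theta> (x - \<theta> j + k, j)" "k \<in> int_vecs"
proof -
  let ?u = "\<lambda>i. \<omega> (n * p + i)"
  have u: "?u \<in> words D" using \<omega> by (simp add: words_def)
  have tail: "encode A (\<eta>, ?u) = ihat_cycle A p \<theta> (0, j)"
  proof (rule solenoid_eqI[OF encode_in_solenoid[OF u] ihat_cycle_in_solenoid])
    fix i
    show "\<exists>N\<ge>i. encode A (\<eta>, ?u) N = ihat_cycle A p \<theta> (0, j) N"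
    proof (intro exI conjI)
      \<comment> \<open>A common multiple of the two periods, at least \<open>i\<close>.\<close>
      show "i \<le> q * (p * i)" 
        using mult_le_mono[of 1 q "1 * i" "p * i"] mult_le_mono1[of 1 p i] periodic_rep_tail(1)[OF rep] p_pos
        by (simp add: Suc_le_eq del: p_pos)
      show "encode A (\<eta>, ?u) (q * (p * i)) = ihat_cycle A p \<theta> (0, j) (q * (p * i))"
        using j periodic_rep_tail(2)[OF rep, of "p * i"]
        by (simp add: encode_def ihat_cycle_def mult.left_commute[of q])
    qed
  qed
  define y where "y = tau_word A \<omega> (n * p) x"
  have y: "y - \<eta> = (M ^^ (n * p)) (x - \<theta> j + k)"
    by (simp add: y_def tau_word_eq k_def funpow_matrix_add funpow_matrix_diff)
  show eq: "encode A (x, \<omega>) = ihat_cycle A p \<theta> (x - \<theta> j + k, j)"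
  proof (rule solenoid_eqI[OF encode_in_solenoid[OF \<omega>] ihat_cycle_in_solenoid])
    fix i
    have "tau_word A \<omega> (n * p + i) x = (M ^^ i) (y - \<eta>) + tau_word A ?u i \<eta>"
      unfolding tau_word_add y_def[symmetric] by (simp add: tau_word_eq funpow_matrix_add funpow_matrix_diff)
    also have "(M ^^ i) (y - \<eta>) = (M ^^ (n * p + i)) (x - \<theta> j + k)"
      unfolding y by (simp add: funpow_add add.commute[of "n * p"])
    finally have "texp (tau_word A \<omega> (n * p + i) x)
        = texp ((M ^^ (n * p + i)) (x - \<theta> j + k)) * texp (tau_word A ?u i \<eta>)" by (simp add: texp_add)
    also have "texp (tau_word A ?u i \<eta>) = texp (th (n * p + i + j))"
      using fun_cong[OF tail, of i] by (simp add: encode_def ihat_cycle_def add.assoc)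
    finally have "encode A (x, \<omega>) (n * p + i) = ihat_cycle A p \<theta> (x - \<theta> j + k, j) (n * p + i)"
      by (simp add: encode_def ihat_cycle_def texp_add)
    then show "\<exists>N\<ge>i. encode A (x, \<omega>) N = ihat_cycle A p \<theta> (x - \<theta> j + k, j) N"
      using le_add2 by blast
  qed
  \<comment> \<open>Integrality of \<open>k\<close> is read off from the zeroth coordinate.\<close>
  have "texp x = texp (x - \<theta> j + k + \<theta> j)"
    using fun_cong[OF eq, of 0] j by (simp add: encode_def ihat_cycle_def)
  then have "- k \<in> int_vecs" by (simp add: texp_eq_iff)
  then show "k \<in> int_vecs" using int_vecs_simps(2)[of "- k"] by simp
qed

text \<open>In the definition of \<open>k_of\<close> the fixed point is not tied to the class of \<open>\<theta>\<^sub>j\<close>; integrality of the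
  resulting vector forces it.  Integrality gives \<open>B\<^sup>n\<^sup>p \<eta> \<equiv> \<theta>\<^sub>j\<close>.  Multiplying by a further power of
  \<open>B\<close> until the total exponent is \<open>q n p\<close>, both sides return to their classes: \<open>\<eta>\<close> because the tail
  word has period \<open>q\<close>, and \<open>\<theta>\<^sub>j\<close> because the further power \<open>(q - 1) n p\<close> is a multiple of \<open>p\<close>.\<close>

lemma periodic_rep_texp_eqI:
  assumes \<omega>: "\<omega> \<in> words D" and rep: "periodic_rep A p \<omega> n q m \<eta>" and j: "j < p"
    and k: "digit_sum \<omega> (n * p) + \<theta> j - (B ^^ (n * p)) \<eta> \<in> int_vecs"
  shows "texp \<eta> = texp (\<theta> j)"
proof -
  let ?u = "\<lambda>i. \<omega> (n * p + i)" and ?T = "torus_pow A"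
  have u: "?u \<in> words D" using \<omega> by (simp add: words_def)
  \<comment> \<open>One of the \<open>q\<close> blocks of \<open>n p\<close> steps leads from \<open>\<eta>\<close> to \<open>\<theta>\<^sub>j\<close>, the other \<open>q - 1\<close> fix \<open>\<theta>\<^sub>j\<close>.\<close>
  obtain q' where q': "q = Suc q'" using periodic_rep_tail(1)[OF rep] by (metis gr0_implies_Suc)
  have "(?T ^^ (n * p)) (texp \<eta>) = texp (\<theta> j)"
  proof -
    have "\<theta> j - (B ^^ (n * p)) \<eta> \<in> int_vecs"
      using int_vecs_simps(4)[OF k digit_sum_int[OF \<omega>, of "n * p"]] by simp
    then have "texp (\<theta> j) = texp ((B ^^ (n * p)) \<eta>)" by (simp add: texp_eq_iff)
    then show ?thesis by (simp add: torus_pow_funpow_texp[OF int_A])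
  qed
  moreover have "(?T ^^ (q' * (n * p))) (texp (\<theta> j)) = texp (\<theta> j)"
    using solenoid_funpow[OF ihat_cycle_in_solenoid[of 0 j], of "q' * (n * p)" 0] j
    by (simp add: ihat_cycle_def flip: mult.assoc)
  moreover have "(?T ^^ (q * (n * p))) (texp \<eta>) = texp \<eta>"
    using solenoid_funpow[OF encode_in_solenoid[OF u, of \<eta>], of "q * (n * p)" 0] periodic_rep_tail(2)[OF rep]
    by (simp add: encode_def)
  moreover have "(?T ^^ (q * (n * p))) (texp \<eta>) = (?T ^^ (q' * (n * p))) ((?T ^^ (n * p)) (texp \<eta>))"
    unfolding q' by (metis funpow_add o_apply add.commute mult_Suc)
  ultimately show ?thesis by simp
qed

text \<open>Every admissible representation of the word computes the preimage of the same solenoid element, so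
  independence of the choices is injectivity of \<open>ihat_cycle\<close>.\<close>

lemma j_of_k_of:
  assumes "\<omega> \<in> \<Omega>\<^sub>C"
  shows "j_of A p \<theta> \<omega> < p" "k_of A p \<theta> \<omega> \<in> int_vecs"
    "encode A (x, \<omega>) = ihat_cycle A p \<theta> (x - \<theta> (j_of A p \<theta> \<omega>) + k_of A p \<theta> \<omega>, j_of A p \<theta> \<omega>)"
proof -
  note \<omega> = Omega_tilde_words[OF assms]
  have inj: "a = b \<and> i = j"
    if "i < p" "j < p" "ihat_cycle A p \<theta> (a, i) = ihat_cycle A p \<theta> (b, j)" for a b i j
    using inj_onD[OF ihat_cycle_inj that(3)] that by auto
  obtain n q m \<eta> j where rep: "periodic_rep A p \<omega> n q m \<eta>" and j: "j < p" "texp \<eta> = texp (\<theta> j)"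
    using Omega_tilde_periodic_rep[OF assms] by blast
  define k where "k = digit_sum \<omega> (n * p) + \<theta> j - (B ^^ (n * p)) \<eta>"
  note enc = encode_periodic_rep[OF \<omega> rep j, folded k_def]
  have j_eq: "j_of A p \<theta> \<omega> = j"
    unfolding j_of_def texp_coset
  proof (rule the_equality)
    fix j' assume "j' < p \<and> (\<exists>n q m \<eta>. periodic_rep A p \<omega> n q m \<eta> \<and> texp \<eta> = texp (\<theta> j'))"
    then show "j' = j" using encode_periodic_rep(1)[OF \<omega>] enc(1) inj j(1) by metis
  qed (use rep j in blast)
  have k_eq: "k_of A p \<theta> \<omega> = k"
    unfolding k_of_def j_eq digit_sum_def[symmetric]
  proof (rule the_equality)
    fix k' assume "k' \<in> int_vecs \<and> (\<exists>n q m \<eta>. periodic_rep A p \<omega> n q m \<eta> \<and>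
        k' = digit_sum \<omega> (n * p) + \<theta> j - (B ^^ (n * p)) \<eta>)"
    then obtain n' q' m' \<eta>' where k': "k' \<in> int_vecs" "periodic_rep A p \<omega> n' q' m' \<eta>'"
        "k' = digit_sum \<omega> (n' * p) + \<theta> j - (B ^^ (n' * p)) \<eta>'" by blast
    then have "texp \<eta>' = texp (\<theta> j)" using periodic_rep_texp_eqI[OF \<omega> k'(2) j(1)] by simp
    then have "encode A (0, \<omega>) = ihat_cycle A p \<theta> (0 - \<theta> j + k', j)"
      unfolding k'(3) by (rule encode_periodic_rep(1)[OF \<omega> k'(2) j(1)])
    then have "0 - \<theta> j + k' = 0 - \<theta> j + k" using enc(1)[of 0] inj j(1) by metis
    then show "k' = k" by simp
  qed (use rep enc(2) k_def in blast)
  show "j_of A p \<theta> \<omega> < p" "k_of A p \<theta> \<omega> \<in> int_vecs"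
    "encode A (x, \<omega>) = ihat_cycle A p \<theta> (x - \<theta> (j_of A p \<theta> \<omega>) + k_of A p \<theta> \<omega>, j_of A p \<theta> \<omega>)"
    unfolding j_eq k_eq using j enc by simp_all
qed

end

section \<open>The tiling and the almost everywhere inverses\<close>

locale tiling_cycle = digit_cycle A D p l \<theta>
  for A :: "real ^ 'n ^ 'n" and D :: "(real ^ 'n) set" and p :: nat and l \<theta> :: "nat \<Rightarrow> real ^ 'n" +
  assumes tiling: "tiling A D"
begin

abbreviation X :: "(real ^ 'n) set" where "X \<equiv> attractor A D"

text \<open>Unique existence makes the pair \<open>(y, k)\<close> available on the complement; the equivalent description
  by unions and overlaps of translates is the one that the tiling condition controls.\<close>

definition nontile :: "(real ^ 'n) set" where
  "nontile = {x. \<not> (\<exists>!k. k \<in> int_vecs \<and> x - k \<in> X)}"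

lemma nontile_eq:
  "nontile = - (\<Union>k \<in> int_vecs. (+) k ` X) \<union>
     (\<Union>k \<in> int_vecs. \<Union>k' \<in> int_vecs - {k}. (+) k ` X \<inter> (+) k' ` X)"
proof -
  have mem: "x \<in> (+) k ` X \<longleftrightarrow> x - k \<in> X" for x k
  proof
    assume "x - k \<in> X"
    then show "x \<in> (+) k ` X" by (intro image_eqI[of _ _ "x - k"]) auto
  qed auto
  show ?thesis unfolding nontile_def set_eq_iff Un_iff Compl_iff UN_iff Int_iff mem by blast
qed

lemma nontile_borel [measurable]: "nontile \<in> sets borel"
proof -
  have [measurable]: "(+) k ` X \<in> sets borel" for k
    by (intro borel_compact compact_translation compact_attractor)
  have "(\<Union>k \<in> I. (+) k ` X) \<in> sets borel" if "I \<subseteq> int_vecs" for I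
    by (intro sets.countable_UN' countable_subset[OF that countable_int_vecs]) auto
  then have "(+) k ` X \<inter> (\<Union>k' \<in> int_vecs - {k}. (+) k' ` X) \<in> sets borel"
    "(\<Union>k \<in> int_vecs. (+) k ` X) \<in> sets borel" for k
    by auto
  then show ?thesis
    unfolding nontile_eq Int_UN_distrib[symmetric]
    by (intro sets.Un borel_comp sets.countable_UN' countable_int_vecs) auto
qed

lemma nontile_null: "nontile \<in> null_sets lebesgue"
  unfolding nontile_eq
  by (intro null_sets.Un null_sets_UN' countable_int_vecs countable_Diff)
     (use tiling in \<open>auto simp: tiling_def\<close>)

lemma emeasure_nontile: "emeasure lborel nontile = 0"
  using nontile_null null_sets_completion_iff[of nontile lborel] by (simp add: null_setsD1)

text \<open>Invariance under integer translations lets the exceptional set be read off from the zeroth coordinate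
  of a solenoid element.\<close>

lemma nontile_texp:
  assumes "texp x = texp y"
  shows "x \<in> nontile \<longleftrightarrow> y \<in> nontile"
proof -
  have *: "y \<in> nontile" if xy: "texp x = texp y" and "x \<in> nontile" for x y
  proof (rule ccontr)
    assume "y \<notin> nontile"
    then have "\<exists>!k. k \<in> int_vecs \<and> y - k \<in> X" by (simp add: nontile_def)
    then obtain k where k: "k \<in> int_vecs" "y - k \<in> X" "\<And>k'. k' \<in> int_vecs \<Longrightarrow> y - k' \<in> X \<Longrightarrow> k' = k"
      by (metis (lifting))
    define e where "e = x - y"
    have e: "e \<in> int_vecs" using xy by (simp add: e_def texp_eq_iff)
    have "\<exists>!k. k \<in> int_vecs \<and> x - k \<in> X"
    proof (rule ex1I[of _ "k + e"])
      have eq: "x - (k + e) = y - k" by (simp add: e_def)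
      show "k + e \<in> int_vecs \<and> x - (k + e) \<in> X"
        unfolding eq using k(2) int_vecs_simps(3)[OF k(1) e] by blast
    next
      fix k' assume k': "k' \<in> int_vecs \<and> x - k' \<in> X"
      have eq: "y - (k' - e) = x - k'" by (simp add: e_def)
      have "k' - e = k"
      proof (rule k(3))
        show "k' - e \<in> int_vecs" using k' e by simp
        show "y - (k' - e) \<in> X" unfolding eq using k' by blast
      qed
      then show "k' = k + e" by (simp add: algebra_simps)
    qed
    then show False using \<open>x \<in> nontile\<close> by (simp add: nontile_def)
  qed
  show ?thesis using *[of x y] *[of y x] assms by metis
qed

lemma tile_unique:
  assumes "y \<in> X" "y' \<in> X" "texp y = texp y'" "y \<notin> nontile"
  shows "y = y'"
proof -
  have "\<exists>!k. k \<in> int_vecs \<and> y - k \<in> X" using assms(4) by (simp add: nontile_def)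
  moreover have "0 \<in> int_vecs \<and> y - 0 \<in> X" "y - y' \<in> int_vecs \<and> y - (y - y') \<in> X"
    using assms(1,2,3) by (simp_all add: texp_eq_iff)
  ultimately have "y - y' = 0" by (metis (lifting))
  then show ?thesis by simp
qed

lemma tile_decomposition:
  assumes "x \<notin> nontile"
  obtains y k where "y \<in> X" "k \<in> int_vecs" "x = y + k"
proof -
  have "\<exists>!k. k \<in> int_vecs \<and> x - k \<in> X" using assms by (simp add: nontile_def)
  then obtain k where "k \<in> int_vecs" "x - k \<in> X" by (elim ex1E conjE)
  then show ?thesis using that[of "x - k" k] by simp
qed

text \<open>Off the exceptional set the zeroth coordinate fixes the tile and the position in it, and then
  \<open>encode_eq_ihat_cycle_iff\<close> fixes the word.\<close>

lemma encode_inverse: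
  assumes j: "j < p" and x: "x + \<theta> j \<notin> nontile" "x + \<theta> j = y + k" and y: "y \<in> X" and k: "k \<in> int_vecs"
    and w: "w \<in> X \<times> \<Omega>\<^sub>C"
  shows "encode A w = ihat_cycle A p \<theta> (x, j) \<longleftrightarrow> w = (y, omega_of A D p \<theta> k j)"
proof -
  have x_eq: "x = y - \<theta> j + k" using x(2) by (simp add: algebra_simps)
  obtain y' \<omega> where w_eq: "w = (y', \<omega>)" "y' \<in> X" "\<omega> \<in> words D"
    using w Omega_tilde_words by (cases w) auto
  have "y = y'" if eq: "encode A w = ihat_cycle A p \<theta> (x, j)"
  proof (rule tile_unique[OF y w_eq(2)])
    have "texp (x + \<theta> j) = texp y" using k by (simp add: x(2))
    moreover have "texp (x + \<theta> j) = texp y'"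
      using fun_cong[OF eq, of 0] j by (simp add: w_eq encode_def ihat_cycle_def)
    ultimately show "texp y = texp y'" "y \<notin> nontile" using nontile_texp[of "x + \<theta> j" y] x(1) by auto
  qed
  then show ?thesis
    using encode_eq_ihat_cycle_iff[OF w_eq(3) k j, of y] by (auto simp: w_eq x_eq)
qed

lemma countable_Omega_tilde: "countable \<Omega>\<^sub>C"
proof (rule countable_subset)
  show "\<Omega>\<^sub>C \<subseteq> (\<lambda>(k, j). omega_of A D p \<theta> k j) ` (int_vecs \<times> {..<p})"
  proof
    fix \<omega> assume \<omega>: "\<omega> \<in> \<Omega>\<^sub>C"
    have "\<omega> = omega_of A D p \<theta> (k_of A p \<theta> \<omega>) (j_of A p \<theta> \<omega>)"
      using encode_eq_ihat_cycle_iff[OF Omega_tilde_words[OF \<omega>] j_of_k_of(2,1)[OF \<omega>], of 0]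
        j_of_k_of(3)[OF \<omega>, of 0] by simp
    then show "\<omega> \<in> (\<lambda>(k, j). omega_of A D p \<theta> k j) ` (int_vecs \<times> {..<p})"
      using j_of_k_of(1,2)[OF \<omega>] by (intro image_eqI[of _ _ "(k_of A p \<theta> \<omega>, j_of A p \<theta> \<omega>)"]) auto
  qed
qed (auto intro: countable_int_vecs)

lemma encode_in_cycle_solenoid:
  assumes "\<omega> \<in> \<Omega>\<^sub>C"
  shows "encode A (x, \<omega>) \<in> cycle_solenoid A p \<theta>"
  unfolding j_of_k_of(3)[OF assms] using bij_betwE[OF bij_betw_ihat_cycle] j_of_k_of(1)[OF assms] by blast

lemma nontile_tlog_encode: "tlog (encode A (x, \<omega>) 0) \<in> nontile \<longleftrightarrow> x \<in> nontile"
  by (intro nontile_texp) (simp add: encode_def texp_tlog)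

text \<open>The exceptional set is removed on both sides through the zeroth coordinate: \<open>tlog\<close> is a Borel
  logarithm, and any logarithm would do by invariance.\<close>

lemma bij_betw_encode:
  "bij_betw (encode A) ((X - nontile) \<times> \<Omega>\<^sub>C) {s \<in> cycle_solenoid A p \<theta>. tlog (s 0) \<notin> nontile}"
proof (rule bij_betw_imageI)
  have key: "\<exists>j x k. j < p \<and> x + \<theta> j \<notin> nontile \<and> k \<in> int_vecs \<and> x + \<theta> j = y + k \<and>
      encode A (y, \<omega>) = ihat_cycle A p \<theta> (x, j)" if "y \<in> X - nontile" "\<omega> \<in> \<Omega>\<^sub>C" for y \<omega>
  proof -
    let ?j = "j_of A p \<theta> \<omega>" and ?k = "k_of A p \<theta> \<omega>"
    have "texp (y + ?k) = texp y" using j_of_k_of(2)[OF that(2)] by simp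
    then have "y + ?k \<notin> nontile" using that(1) nontile_texp by blast
    then show ?thesis using j_of_k_of[OF that(2)]
      by (intro exI[of _ ?j] exI[of _ "y - \<theta> ?j + ?k"] exI[of _ ?k]) (simp add: algebra_simps)
  qed
  show "inj_on (encode A) ((X - nontile) \<times> \<Omega>\<^sub>C)"
  proof (rule inj_onI)
    fix v w assume v: "v \<in> (X - nontile) \<times> \<Omega>\<^sub>C" and w: "w \<in> (X - nontile) \<times> \<Omega>\<^sub>C" and eq: "encode A v = encode A w"
    obtain y \<omega> where y: "v = (y, \<omega>)" "y \<in> X - nontile" "\<omega> \<in> \<Omega>\<^sub>C" using v by auto
    obtain j x k where jx: "j < p" "x + \<theta> j \<notin> nontile" "x + \<theta> j = y + k" "y \<in> X" "k \<in> int_vecs"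
      "encode A v = ihat_cycle A p \<theta> (x, j)"
      using key[OF y(2,3)] y by blast
    show "v = w" using encode_inverse[OF jx(1-5), of v] encode_inverse[OF jx(1-5), of w] jx(6) v w eq by auto
  qed
  show "encode A ` ((X - nontile) \<times> \<Omega>\<^sub>C) = {s \<in> cycle_solenoid A p \<theta>. tlog (s 0) \<notin> nontile}"
  proof (intro equalityI subsetI)
    fix s assume "s \<in> {s \<in> cycle_solenoid A p \<theta>. tlog (s 0) \<notin> nontile}"
    then obtain x j where s: "s = ihat_cycle A p \<theta> (x, j)" "j < p" "tlog (s 0) \<notin> nontile"
      unfolding ihat_cycle_image[symmetric] by auto
    have "texp (tlog (s 0)) = texp (x + \<theta> j)" using s by (simp add: ihat_cycle_def texp_tlog)
    then have x: "x + \<theta> j \<notin> nontile" using nontile_texp s(3) by blast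
    obtain y k where yk: "y \<in> X" "k \<in> int_vecs" "x + \<theta> j = y + k" using tile_decomposition[OF x] by blast
    have "texp (x + \<theta> j) = texp y" using yk by simp
    then have "y \<notin> nontile" using x nontile_texp by blast
    let ?w = "(y, omega_of A D p \<theta> k j)"
    have "?w \<in> (X - nontile) \<times> \<Omega>\<^sub>C" using yk \<open>y \<notin> nontile\<close> omega_of_in_Omega_tilde s(2) by auto
    moreover have "encode A ?w = s"
      using encode_inverse[OF s(2) x yk(3,1,2), of ?w] calculation s(1) by auto
    ultimately show "s \<in> encode A ` ((X - nontile) \<times> \<Omega>\<^sub>C)" by blast
  qed (auto simp: encode_in_cycle_solenoid nontile_tlog_encode)
qed

text \<open>Countability of the set of words makes its counting measure \<open>\<sigma>\<close>-finite, so that products with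
  a null set are null.\<close>

lemma null_sets_attractor_words:
  assumes "N \<in> null_sets lebesgue"
  shows "(X \<inter> N) \<times> \<Omega>\<^sub>C \<in> null_sets (attractor_words A D p \<theta>)"
proof -
  have "X \<in> sets lebesgue" using borel_compact[OF compact_attractor] by simp
  then have "X \<inter> N \<in> null_sets (lebesgue_on X)"
    using assms by (simp add: null_sets_restrict_space null_set_Int1)
  then show ?thesis unfolding attractor_words_def
    by (intro sigma_finite_measure.times_in_null_sets1 sigma_finite_measure_count_space_countable
        countable_Omega_tilde) auto
qed

lemma space_attractor_words: "space (attractor_words A D p \<theta>) = X \<times> \<Omega>\<^sub>C"
  by (simp add: attractor_words_def space_pair_measure space_restrict_space)

text \<open>For almost every \<open>z\<close> in the torus the fibre over \<open>z\<close> misses the set altogether, so the fibre sums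
  vanish although the fibres are infinite.\<close>

lemma null_sets_mu_tilde: "{s \<in> cycle_solenoid A p \<theta>. tlog (s 0) \<in> nontile} \<in> null_sets (mu_tilde A p \<theta>)"
proof -
  let ?S = "cycle_solenoid A p \<theta>"
  let ?T = "{s \<in> ?S. tlog (s 0) \<in> nontile}"
  have [measurable]: "(\<lambda>s :: nat \<Rightarrow> complex ^ 'n. s 0) \<in> borel_measurable borel"
    by (intro borel_measurable_continuous_onI continuous_on_product_coordinates)
  have "{s. tlog (s 0) \<in> nontile} \<in> sets borel" by measurable
  then have T: "?T \<in> sets (restrict_space borel ?S)"
    by (auto simp: sets_restrict_space)
  let ?E = "{z \<in> torus. tlog z \<in> nontile}"
  have cl: "closed (torus :: (complex ^ 'n) set)"
    unfolding torus_def by (intro closed_Collect_all closed_Collect_eq continuous_intros)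
  have [measurable]: "(torus :: (complex ^ 'n) set) \<in> sets borel" using cl by (rule borel_closed)
  have E: "?E \<in> sets borel" by measurable
  have "emeasure torus_haar ?E \<le> emeasure lborel nontile"
  proof (subst emeasure_torus_haar[OF E])
    have "texp x \<in> ?E \<Longrightarrow> x \<in> nontile" for x
      using nontile_texp[of "tlog (texp x)" x] by (simp add: texp_tlog)
    then show "emeasure lborel {x. (\<forall>i. 0 \<le> x $ i \<and> x $ i < 1) \<and> texp x \<in> ?E} \<le> emeasure lborel nontile"
      by (intro emeasure_mono) auto
  qed auto
  then have "emeasure torus_haar ?E = 0" by (simp add: emeasure_nontile)
  moreover have "?E \<in> sets torus_haar" using E by (auto simp: sets_torus_haar sets_restrict_space)
  ultimately have ae: "AE z in torus_haar. tlog z \<notin> nontile"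
    by (intro AE_I[of _ _ ?E]) (auto simp: space_torus_haar)
  have "(\<integral>\<^sup>+ z. (\<integral>\<^sup>+ s. indicator ?T s \<partial>count_space {s \<in> ?S. s 0 = z}) \<partial>torus_haar)
      = (\<integral>\<^sup>+ z. 0 \<partial>(torus_haar :: (complex ^ 'n) measure))"
  proof (rule nn_integral_cong_AE)
    have "(\<integral>\<^sup>+ s. indicator ?T s \<partial>count_space {s \<in> ?S. s 0 = z}) = 0" if "tlog z \<notin> nontile" for z
    proof -
      have "(\<integral>\<^sup>+ s. indicator ?T s \<partial>count_space {s \<in> ?S. s 0 = z}) = (\<integral>\<^sup>+ s. 0 \<partial>count_space {s \<in> ?S. s 0 = z})"
        using that by (intro nn_integral_cong) (auto simp: indicator_def)
      then show ?thesis by simp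
    qed
    with ae show "AE z in torus_haar. (\<integral>\<^sup>+ s. indicator ?T s \<partial>count_space {s \<in> ?S. s 0 = z}) = 0"
      by (rule eventually_mono)
  qed
  moreover have "D \<subseteq> int_vecs" using D_int by blast
  ultimately have "emeasure (mu_tilde A p \<theta>) ?T = 0"
    using emeasure_mu_tilde[OF int_A exp_A _ cycle T] by simp
  then show ?thesis using T by (intro null_setsI) (simp_all add: sets_mu_tilde)
qed

lemma bij_betw_ae_encode: "bij_betw_ae (encode A) (attractor_words A D p \<theta>) (mu_tilde A p \<theta>)"
proof -
  have 1: "space (attractor_words A D p \<theta>) - (X \<inter> nontile) \<times> \<Omega>\<^sub>C = (X - nontile) \<times> \<Omega>\<^sub>C"
    by (auto simp: space_attractor_words)
  have 2: "space (mu_tilde A p \<theta>) - {s \<in> cycle_solenoid A p \<theta>. tlog (s 0) \<in> nontile}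
      = {s \<in> cycle_solenoid A p \<theta>. tlog (s 0) \<notin> nontile}"
    by (auto simp: space_mu_tilde)
  show ?thesis unfolding bij_betw_ae_def
    by (rule bexI[OF _ null_sets_attractor_words[OF nontile_null]], rule bexI[OF _ null_sets_mu_tilde])
       (simp only: 1 2 bij_betw_encode)
qed

lemma AE_decomposition: "AE (x, j) in space_cyc p. j < p \<and> x + \<theta> j \<notin> nontile"
proof (rule AE_I')
  have "(\<Union>j<p. (+) (- \<theta> j) ` nontile) \<in> null_sets lebesgue"
    using negligible_translation nontile_null by (intro null_sets_UN') (auto simp only: countable_finite finite_lessThan negligible_iff_null_sets)
  then show "(\<Union>j<p. (+) (- \<theta> j) ` nontile) \<times> {..<p} \<in> null_sets (space_cyc p)"
    unfolding space_cyc_def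
    by (intro sigma_finite_measure.times_in_null_sets1 sigma_finite_measure_count_space_countable) auto
  show "{xj \<in> space (space_cyc p). \<not> (case xj of (x, j) \<Rightarrow> j < p \<and> x + \<theta> j \<notin> nontile)}
      \<subseteq> (\<Union>j<p. (+) (- \<theta> j) ` nontile) \<times> {..<p}"
  proof
    fix xj assume "xj \<in> {xj \<in> space (space_cyc p). \<not> (case xj of (x, j) \<Rightarrow> j < p \<and> x + \<theta> j \<notin> nontile)}"
    then obtain x j where "xj = (x, j)" "j < p" "x + \<theta> j \<in> nontile"
      by (auto simp: space_cyc_def space_pair_measure)
    moreover have "x = - \<theta> j + (x + \<theta> j)" by simp
    ultimately show "xj \<in> (\<Union>j<p. (+) (- \<theta> j) ` nontile) \<times> {..<p}" by blast
  qed
qed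

text \<open>The digit of \<open>x\<close> is ambiguous only if \<open>B x\<close> lies in two integer translates of the attractor, and
  linear maps preserve null sets.\<close>

lemma AE_B_nontile: "AE w in attractor_words A D p \<theta>. w \<in> X \<times> \<Omega>\<^sub>C \<and> B (fst w) \<notin> nontile"
proof (rule AE_I')
  have "M differentiable_on nontile"
    by (intro linear_imp_differentiable_on matrix_vector_mul_linear)
  then have "M ` nontile \<in> null_sets lebesgue"
    using nontile_null negligible_differentiable_image_negligible[of nontile M]
    by (simp add: negligible_iff_null_sets)
  then show "(X \<inter> M ` nontile) \<times> \<Omega>\<^sub>C \<in> null_sets (attractor_words A D p \<theta>)"
    by (rule null_sets_attractor_words)
  show "{w \<in> space (attractor_words A D p \<theta>). \<not> (w \<in> X \<times> \<Omega>\<^sub>C \<and> B (fst w) \<notin> nontile)} \<subseteq> (X \<inter> M ` nontile) \<times> \<Omega>\<^sub>C"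
    by (auto simp: space_attractor_words) (metis MB imageI)
qed

text \<open>Prepending the digit \<open>d\<close> of \<open>x\<close> undoes the step from \<open>x\<close> to \<open>B x - d\<close>, so from the first coordinate on the
  code is that of \<open>(x, \<omega>)\<close>, delayed by one; in the zeroth coordinate the integer vector \<open>d\<close> is invisible.\<close>

lemma encode_rho_inv:
  assumes x: "x \<in> X" and \<omega>: "\<omega> \<in> \<Omega>\<^sub>C" and B: "B x \<notin> nontile"
  shows "rho_inv A D (x, \<omega>) \<in> X \<times> \<Omega>\<^sub>C" "encode A (rho_inv A D (x, \<omega>)) = sigma_map A (encode A (x, \<omega>))"
proof -
  obtain d where d: "d \<in> D" "B x - d \<in> X" using attractor_digit[OF x] by blast
  have digit: "digit A D x = d"
    unfolding digit_def mem_tau_image_attractor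
  proof (rule the_equality)
    fix d' assume d': "d' \<in> D \<and> B x - d' \<in> X"
    have "\<exists>!k. k \<in> int_vecs \<and> B x - k \<in> X" using B by (simp add: nontile_def)
    then show "d' = d" using d d' D_int by (metis (lifting))
  qed (use d in simp)
  show "rho_inv A D (x, \<omega>) \<in> X \<times> \<Omega>\<^sub>C"
    using d \<omega> by (simp add: rho_inv_def digit Omega_tilde_shift)
  have tw: "tau_word A (case_nat d \<omega>) (Suc n) (B x - d) = tau_word A \<omega> n x" for n
    using tau_word_add[of A "case_nat d \<omega>" 1 n "B x - d"] by (simp add: tau_def)
  show "encode A (rho_inv A D (x, \<omega>)) = sigma_map A (encode A (x, \<omega>))"
  proof
    fix n
    show "encode A (rho_inv A D (x, \<omega>)) n = sigma_map A (encode A (x, \<omega>)) n"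
    proof (cases n)
      case 0
      then show ?thesis
        using D_int[OF d(1)] by (simp add: encode_def rho_inv_def digit sigma_map_def torus_pow_texp[OF int_A])
    next
      case (Suc m)
      then show ?thesis
        by (simp only: encode_def rho_inv_def digit sigma_map_def prod.case tw nat.case)
    qed
  qed
qed

lemma sigma_map_cycle_solenoid: "sigma_map A \<in> cycle_solenoid A p \<theta> \<rightarrow> cycle_solenoid A p \<theta>"
proof
  fix s assume "s \<in> cycle_solenoid A p \<theta>"
  then obtain x j where s: "s = ihat_cycle A p \<theta> (x, j)" "j < p"
    unfolding ihat_cycle_image[symmetric] by auto
  then have "sigma_map A s = ihat_cycle A p \<theta> (alpha A p (x, j))" by (simp add: ihat_cycle_alpha)
  moreover have "ihat_cycle A p \<theta> (alpha A p (x, j)) \<in> ihat_cycle A p \<theta> ` (UNIV \<times> {..<p})"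
    by (rule imageI) (simp add: alpha_def)
  ultimately show "sigma_map A s \<in> cycle_solenoid A p \<theta>" by (simp only: ihat_cycle_image)
qed

lemma inv_into_ihat_cycle_encode:
  assumes "\<omega> \<in> \<Omega>\<^sub>C"
  shows "inv_into (UNIV \<times> {..<p}) (ihat_cycle A p \<theta>) (encode A (x, \<omega>)) =
    (x - \<theta> (j_of A p \<theta> \<omega>) + k_of A p \<theta> \<omega>, j_of A p \<theta> \<omega>)"
  using j_of_k_of[OF assms] by (intro inv_into_f_eq[OF ihat_cycle_inj]) auto

lemma encode_unique_preimage:
  assumes j: "j < p" and x: "x + \<theta> j \<notin> nontile"
  shows "\<exists>!(y, k). y \<in> X \<and> k \<in> int_vecs \<and> x + \<theta> j = y + k"
    and "\<exists>!w. w \<in> X \<times> \<Omega>\<^sub>C \<and> encode A w = ihat_cycle A p \<theta> (x, j)"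
    and "y \<in> X \<Longrightarrow> k \<in> int_vecs \<Longrightarrow> x + \<theta> j = y + k \<Longrightarrow>
      inv_into (X \<times> \<Omega>\<^sub>C) (encode A) (ihat_cycle A p \<theta> (x, j)) = (y, omega_of A D p \<theta> k j)"
proof -
  obtain y0 k0 where yk: "y0 \<in> X" "k0 \<in> int_vecs" "x + \<theta> j = y0 + k0" using tile_decomposition[OF x] by blast
  show "\<exists>!(y, k). y \<in> X \<and> k \<in> int_vecs \<and> x + \<theta> j = y + k"
  proof (rule ex1I[of _ "(y0, k0)"])
    fix a assume a: "case a of (y, k) \<Rightarrow> y \<in> X \<and> k \<in> int_vecs \<and> x + \<theta> j = y + k"
    obtain y k where y: "a = (y, k)" "y \<in> X" "k \<in> int_vecs" "x + \<theta> j = y + k" using a by (cases a) auto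
    have "x + \<theta> j - k \<in> X" "x + \<theta> j - k0 \<in> X" using y yk by (metis add_diff_cancel_right')+
    moreover have "\<exists>!k. k \<in> int_vecs \<and> x + \<theta> j - k \<in> X" using x by (simp add: nontile_def)
    ultimately have "k = k0" using y(3) yk(2) by (metis (lifting))
    then show "a = (y0, k0)" using y yk(3) by simp
  qed (use yk in simp)
  have w: "(y, omega_of A D p \<theta> k j) \<in> X \<times> \<Omega>\<^sub>C" if "y \<in> X" "k \<in> int_vecs" for y k
    using that j omega_of_in_Omega_tilde by simp
  show "\<exists>!w. w \<in> X \<times> \<Omega>\<^sub>C \<and> encode A w = ihat_cycle A p \<theta> (x, j)"
  proof (rule ex1I[of _ "(y0, omega_of A D p \<theta> k0 j)"])
    show "(y0, omega_of A D p \<theta> k0 j) \<in> X \<times> \<Omega>\<^sub>C \<and>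
        encode A (y0, omega_of A D p \<theta> k0 j) = ihat_cycle A p \<theta> (x, j)"
      using encode_inverse[OF j x yk(3,1,2) w[OF yk(1,2)]] w[OF yk(1,2)] by simp
  next
    fix v assume "v \<in> X \<times> \<Omega>\<^sub>C \<and> encode A v = ihat_cycle A p \<theta> (x, j)"
    then show "v = (y0, omega_of A D p \<theta> k0 j)" using encode_inverse[OF j x yk(3,1,2), of v] by simp
  qed
  show "inv_into (X \<times> \<Omega>\<^sub>C) (encode A) (ihat_cycle A p \<theta> (x, j)) = (y, omega_of A D p \<theta> k j)"
    if "y \<in> X" "k \<in> int_vecs" "x + \<theta> j = y + k"
  proof -
    let ?w = "(y, omega_of A D p \<theta> k j)"
    have "ihat_cycle A p \<theta> (x, j) \<in> encode A ` (X \<times> \<Omega>\<^sub>C)"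
      using encode_inverse[OF j x that(3,1,2) w[OF that(1,2)]] w[OF that(1,2)] by (metis imageI)
    from inv_into_into[OF this] f_inv_into_f[OF this] show ?thesis
      using encode_inverse[OF j x that(3,1,2)] by simp
  qed
qed

end

theorem corollary6p16:
  fixes A :: "real ^ 'n ^ 'n" and D :: "(real ^ 'n) set"
    and p :: nat and l \<theta> :: "nat \<Rightarrow> real ^ 'n"
  assumes "int_matrix A" and "expansive A"
    and "complete_residues A D"
    and "tiling A D"
    and "simple_cycle A D p l \<theta>"
  shows
    "(encode A \<in> attractor A D \<times> Omega_tilde A D p \<theta> \<rightarrow> cycle_solenoid A p \<theta> \<and>
      bij_betw_ae (encode A) (attractor_words A D p \<theta>) (mu_tilde A p \<theta>) \<and>
      bij_betw (ihat_cycle A p \<theta>) (UNIV \<times> {..<p}) (cycle_solenoid A p \<theta>))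
     \<and>
     ((\<forall>x \<in> attractor A D. \<forall>\<omega> \<in> Omega_tilde A D p \<theta>.
         inv_into (UNIV \<times> {..<p}) (ihat_cycle A p \<theta>) (encode A (x, \<omega>)) =
           (x - \<theta> (j_of A p \<theta> \<omega>) + k_of A p \<theta> \<omega>, j_of A p \<theta> \<omega>)) \<and>
      (AE (x, j) in space_cyc p.
         (\<exists>!(y, k). y \<in> attractor A D \<and> k \<in> int_vecs \<and> x + \<theta> j = y + k) \<and>
         (\<exists>!w. w \<in> attractor A D \<times> Omega_tilde A D p \<theta> \<and> encode A w = ihat_cycle A p \<theta> (x, j)) \<and>
         (\<forall>y \<in> attractor A D. \<forall>k \<in> int_vecs. x + \<theta> j = y + k \<longrightarrow>
            inv_into (attractor A D \<times> Omega_tilde A D p \<theta>) (encode A) (ihat_cycle A p \<theta> (x, j)) =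
              (y, omega_of A D p \<theta> k j))))
     \<and>
     ((AE w in attractor_words A D p \<theta>.
         rho_inv A D w \<in> attractor A D \<times> Omega_tilde A D p \<theta> \<and>
         encode A (rho_inv A D w) = sigma_map A (encode A w)) \<and>
      sigma_map A \<in> cycle_solenoid A p \<theta> \<rightarrow> cycle_solenoid A p \<theta> \<and>
      (\<forall>x. \<forall>j<p. ihat_cycle A p \<theta> (alpha A p (x, j)) = sigma_map A (ihat_cycle A p \<theta> (x, j))))"
proof -
  interpret tiling_cycle A D p l \<theta>
    by unfold_locales (fact assms)+
  show ?thesis
  proof (intro conjI)
    show "encode A \<in> X \<times> \<Omega>\<^sub>C \<rightarrow> cycle_solenoid A p \<theta>" using encode_in_cycle_solenoid by auto
    show "\<forall>x\<in>X. \<forall>\<omega>\<in>\<Omega>\<^sub>C. inv_into (UNIV \<times> {..<p}) (ihat_cycle A p \<theta>) (encode A (x, \<omega>)) =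
        (x - \<theta> (j_of A p \<theta> \<omega>) + k_of A p \<theta> \<omega>, j_of A p \<theta> \<omega>)"
      using inv_into_ihat_cycle_encode by blast
    show "AE (x, j) in space_cyc p.
         (\<exists>!(y, k). y \<in> X \<and> k \<in> int_vecs \<and> x + \<theta> j = y + k) \<and>
         (\<exists>!w. w \<in> X \<times> \<Omega>\<^sub>C \<and> encode A w = ihat_cycle A p \<theta> (x, j)) \<and>
         (\<forall>y \<in> X. \<forall>k \<in> int_vecs. x + \<theta> j = y + k \<longrightarrow>
            inv_into (X \<times> \<Omega>\<^sub>C) (encode A) (ihat_cycle A p \<theta> (x, j)) = (y, omega_of A D p \<theta> k j))"
      using AE_decomposition
    proof (rule eventually_mono, clarify)
      fix x j assume "j < p" "x + \<theta> j \<notin> nontile"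
      note * = encode_unique_preimage[OF this]
      show "(\<exists>!(y, k). y \<in> X \<and> k \<in> int_vecs \<and> x + \<theta> j = y + k) \<and>
         (\<exists>!w. w \<in> X \<times> \<Omega>\<^sub>C \<and> encode A w = ihat_cycle A p \<theta> (x, j)) \<and>
         (\<forall>y \<in> X. \<forall>k \<in> int_vecs. x + \<theta> j = y + k \<longrightarrow>
            inv_into (X \<times> \<Omega>\<^sub>C) (encode A) (ihat_cycle A p \<theta> (x, j)) = (y, omega_of A D p \<theta> k j))"
        using *(3) by (intro conjI *(1,2)) blast
    qed
    show "AE w in attractor_words A D p \<theta>. rho_inv A D w \<in> X \<times> \<Omega>\<^sub>C \<and>
         encode A (rho_inv A D w) = sigma_map A (encode A w)"
      using AE_B_nontile
    proof (rule eventually_mono)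
      fix w assume w: "w \<in> X \<times> \<Omega>\<^sub>C \<and> B (fst w) \<notin> nontile"
      obtain x \<omega> where "w = (x, \<omega>)" "x \<in> X" "\<omega> \<in> \<Omega>\<^sub>C" "B x \<notin> nontile" using w by (cases w) auto
      then show "rho_inv A D w \<in> X \<times> \<Omega>\<^sub>C \<and> encode A (rho_inv A D w) = sigma_map A (encode A w)"
        using encode_rho_inv by simp
    qed
  qed (use bij_betw_ae_encode bij_betw_ihat_cycle sigma_map_cycle_solenoid ihat_cycle_alpha in blast)+
qed

end
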